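(* Let $\Gamma\subset\mathbb C$ be a lattice, $\lambda\in\mathbb C$ with $|\lambda|\ne1$, $Z\subset\mathcal M=(\mathbb C/\Gamma)\times\mathbb R$ a finite subset, and $(E,h,\nabla,\phi)$ a meromorphic monopole on $\mathcal M\setminus Z$. For each choice $(\mathsf e_1,\mathsf s_1)$ (i.e. an oriented basis $\mu_1,\mu_2$ of $\Gamma$ and a solution $\mathsf s_1$, see context) let $\widetilde{\mathsf E}_{(\mathsf e_1,\mathsf s_1)*}$ be the associated locally free $\mathcal O_{T^\lambda}( *\mathsf D)$-module with $q^\lambda(\mathsf e_1,\mathsf s_1)$-difference parabolic structure on the elliptic curve $T^\lambda$. Then the rescaled filtered objects $$\mathsf H^{(\mathfrak t^\lambda(\mathsf e_1,\mathsf s_1))}\bigl(\widetilde{\mathsf E}_{(\mathsf e_1,\mathsf s_1)*}\bigr)$$ on $T^\lambda$ are independent of the choice of $(\mathsf e_1,\mathsf s_1)$.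
   Context: **Monopoles.** $\mathcal M=(\mathbb C_z/\Gamma)\times\mathbb R_{y_0}$ with metric $dz\,d\bar z+dy_0^2$, orientation $\frac{\sqrt{-1}}2dz\wedge d\bar z\wedge dy_0$. A monopole is $(E,h,\nabla,\phi)$: vector bundle, Hermitian metric, unitary connection, anti-self-adjoint endomorphism with $F(\nabla)=\ast\nabla\phi$. It is meromorphic on $\mathcal M\setminus Z$ if each point of $Z$ is a Dirac type singularity (in the sense of Kronheimer: the $S^1$-equivariant instanton obtained by pull back via the Hopf map $\mathbb R^4\to\mathbb R^3$ extends smoothly over the origin) and $F(\nabla)$ is bounded outside a compact set containing $Z$. **Choices.** Let $\mu_1,\mu_2$ be a basis of $\Gamma$ with $\mathrm{Im}(\mu_2/\mu_1)>0$ ($\mathsf e_1,\mathsf e_2$ denote the corresponding translations), and let $\mathsf s_1\in\mathbb R$, $\mathsf g_1\in\mathbb C$, $|\mathsf g_1|=1$, satisfy $-\lambda\bar\mu_1+\mathsf s_1=\mathsf g_1(\mu_1+\lambda \mathsf s_1)\neq0$ (for $|\lambda|\ne1$ there are two solutions). Put $\alpha=\frac{z+\lambda^2\bar z-2\sqrt{-1}\lambda y_0}{1+|\lambda|^2}$, $\tau=\frac{(1-|\lambda|^2)y_0+2\mathrm{Im}(\bar\lambda z)}{1+|\lambda|^2}$, $u=\frac{1+|\lambda|^2}{1-\mathsf g_1\lambda}\alpha$, $\mathsf t=\mathrm{Im}\bigl(\frac{-\mathsf g_1z-\lambda\bar z+\sqrt{-1}(1+\mathsf g_1\lambda)y_0}{1-\mathsf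 g_1\lambda}\bigr)$, $U=\exp\bigl(\frac{2\pi\sqrt{-1}}{\mu_1+\lambda \mathsf s_1}u\bigr)$, $q=q^\lambda(\mathsf e_1,\mathsf s_1)=\exp\bigl(2\pi\sqrt{-1}\frac{\mu_2+\lambda^2\bar\mu_2}{\mu_1+\lambda^2\bar\mu_1}\bigr)$ (so $|q|\neq1$), $\mathfrak t^\lambda=\mathfrak t^\lambda(\mathsf e_1,\mathsf s_1)=-\mathrm{Vol}(\Gamma)/\mathrm{Re}(\mathsf g_1\mu_1)\ne0$. $(U,\mathsf t)$ identifies $(\mathbb C_z/\mathbb Z\mu_1)\times\mathbb R$ with $\mathbb C^*\times\mathbb R$, translation by $\mu_2$ being $(U,\mathsf t)\mapsto(qU,\mathsf t+\mathfrak t^\lambda)$; with $y=U$, $\mathsf t=\mathfrak t^\lambda t$ this identifies $\mathcal M$ with $\mathcal M_q:=(\mathbb C^*\times\mathbb R)/\mathbb Z$, action $n\bullet(y,t)=(q^ny,t+n)$. The elliptic curve $T^\lambda=\mathbb C/\{\chi+\lambda^2\bar\chi:\chi\in\Gamma\}$ is identified with $T=\mathbb C^*/q^{\mathbb Z}$ by $x\mapsto \exp(2\pi\sqrt{-1}x/(\mu_1+\lambda^2\bar\mu_1))$; the projection $\mathsf p:\mathcal M\to T^\lambda$, $(z,y_0)\mapsto z+\lambda^2\bar z-2\sqrt{-1}\lambda y_0$, is induced by $(y,t)\mapsto y$. Also $\mathsf f:\mathcal M_q\to\mathbb R$ is induced by $\mathsf f(y,t)=t-\log|y|/\log|q|$.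 **The module on $\overline{\mathcal M}_q$.** $\overline{\mathcal M}_q=(\mathbb P^1\times\mathbb R)/\mathbb Z$, $H_q$ the image of $\{0,\infty\}\times\mathbb R$, and $\mathcal O_{\overline{\mathcal M}_q}( *H_q)$ the descent of the pull back of $\mathcal O_{\mathbb P^1}( *\{0,\infty\})$ (sections locally constant in $t$). From the monopole: let $\mathcal E$ be the sheaf of sections $s$ of $E$ with $\nabla_{\partial_{\bar\alpha}}s=0$, $(\nabla_{\partial_\tau}-\sqrt{-1}\phi)s=0$. It extends to a locally free $\mathcal O_{\overline{\mathcal M}_q\setminus Z}( *H_q)$-module $\mathfrak V$ (sections of moderate growth), and on each slice $t=$ const, near $U=\nu\in\{0,\infty\}$ with $U_0=U,U_\infty=U^{-1}$, $\mathcal P_a$ consists of holomorphic sections with $|s|_h=O(|U_\nu|^{-a-\epsilon})$ for all $\epsilon>0$. Sections of $\mathfrak V$ can be transported (flatly) along segments $\{y\}\times[t_1,t_2]$ in the complement of the preimage $Z^{cov}$ of $Z$ in $\mathbb C^*\times\mathbb R$ (scattering); across a point of $Z^{cov}$ this is meromorphic. **$q$-difference parabolic structure on $T$.** For a finite $\mathsf D\subset T$ and a locally free $\mathcal O_T( *\mathsf D)$-module $\widetilde{\mathsf E}$ it consists of: finite sequences $\mathbf s_P=(s_{P,1}<\dots<s_{P,m(P)})$ in $\mathbb R$ and lattices $\mathcal K_{P,0},\dots,\mathcal K_{P,m(P)}$ of the formal completion $\widetilde{\mathsf E}_{|\widehat P}$ for each $P\in \mathsf D$; letting $\mathsf E_-$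 (resp. $\mathsf E_+$) be the $\mathcal O_T$-lattice of $\widetilde{\mathsf E}$ determined by all $\mathcal K_{P,0}$ (resp. $\mathcal K_{P,m(P)}$), increasing filtrations $\mathfrak F_\pm$ of $\mathsf E_\pm$ indexed by $(\mathbb Q,\le)$ with $\mathrm{Gr}^{\mathfrak F_\pm}_\mu$ semistable of slope $\deg/\mathrm{rank}=\mu$ (or zero); and filtrations $\mathcal F_\pm$ indexed by $(\mathbb R,\leq)$ of each $\mathrm{Gr}^{\mathfrak F_\pm}_\mu(\mathsf E_\pm)$ with graded pieces semistable of slope $\mu$ (or zero). **$\widetilde{\mathsf E}_{(\mathsf e_1,\mathsf s_1)*}$.** $\mathsf D=\mathsf p(Z)$, $\mathbf s_P$ lists $\mathsf f(\mathsf p^{-1}(P)\cap Z)$ increasingly. Scattering makes $\mathfrak V$ over $\mathsf p^{-1}(T\setminus \mathsf D)$ a vector bundle on $T\setminus\mathsf D$, which extends to an $\mathcal O_T( *\mathsf D)$-module $\widetilde{\mathsf E}$ by gluing $\mathfrak V^{cov}|_{W\times\{t_P\}}( *\alpha_P)$ for $(\alpha_P,t_P)\notin Z^{cov}$ over $P$ and $W$ a small disc; $\mathcal K_{P,i}$ is the completed stalk of $\mathfrak V$ at a point of $\mathsf p^{-1}(P)$ with $s_{P,i}<\mathsf f<s_{P,i+1}$ ($s_{P,0}=-\infty$, $s_{P,m(P)+1}=\infty$). The filtrations at sign $\pm$ come from the end $\mathsf f\to\pm\infty$ (one of $H_{q,0},H_{q,\infty}$): for $Q\in T$ and $s\in\mathsf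 E_{\pm|Q}$ with flat extension $\tilde s$ along $\mathsf p^{-1}(Q)$ towards that end, $s\in\mathfrak F_{\pm,\mu}$ iff for all $\epsilon>0$, $|\tilde s|_h=O\bigl(\exp((\tfrac\mu2|\log|q||+\epsilon)\mathsf f^2)\bigr)$; and for $s\in\mathfrak F_{\pm,\mu}$ its class in $\mathrm{Gr}_\mu$ lies in $\mathcal F_{\pm,b}$ iff for all $\epsilon>0$, $|\tilde s|_h=O\bigl(\exp(\tfrac\mu2|\log|q||\mathsf f^2+(b+\epsilon)|\log|q||\,|\mathsf f|)\bigr)$. **Rescaling $\mathsf H^{(c)}$, $c\in\mathbb R\setminus\{0\}$.** If $c>0$: replace $s_{P,i}$ by $c\,s_{P,i}$, keep $\mathcal K_{P,i}$ and $\mathfrak F_\pm$, and set $(\mathcal F^{(c)}_\pm)_{ca}=(\mathcal F_\pm)_a$. If $c<0$: $s^{(c)}_{P,i}=c\,s_{P,m(P)-i+1}$, $\mathcal K^{(c)}_{P,i}=\mathcal K_{P,m(P)-i}$, $\mathfrak F^{(c)}_\pm=\mathfrak F_\mp$, $(\mathcal F^{(c)}_\pm)_{|c|a}=(\mathcal F_\mp)_a$. *)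

theory Defs
  imports "HOL-Analysis.Analysis" "HOL-Library.Landau_Symbols"
begin

section \<open>Smooth maps\<close>

fun Ck_on :: "nat \<Rightarrow> 'a::real_normed_vector set \<Rightarrow> ('a \<Rightarrow> 'b::real_normed_vector) \<Rightarrow> bool" where
  "Ck_on 0 S f \<longleftrightarrow> continuous_on S f"
| "Ck_on (Suc k) S f \<longleftrightarrow> (\<forall>x\<in>S. f differentiable (at x)) \<and>
     (\<forall>v. Ck_on k S (\<lambda>x. frechet_derivative f (at x) v))"

definition smooth_on :: "'a::real_normed_vector set \<Rightarrow> ('a \<Rightarrow> 'b::real_normed_vector) \<Rightarrow> bool" where
  "smooth_on S f \<longleftrightarrow> (\<forall>k. Ck_on k S f)"


section \<open>The three-manifold\<close>

text \<open>
  The manifold \<open>(\<complex>/\<Gamma>) \<times> \<real>\<close> is handled through its cover \<open>\<complex> \<times> \<real>\<close>: subsets of the quotient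
  are \<open>\<Gamma>\<close>-periodic subsets of the cover, and functions on the quotient are \<open>\<Gamma>\<close>-periodic
  functions.  The finite set \<open>Z\<close> is given by representatives in the cover.
\<close>

type_synonym pt = "complex \<times> real"

definition oriented_basis :: "complex set \<Rightarrow> complex \<Rightarrow> complex \<Rightarrow> bool" where
  "oriented_basis \<Gamma> \<mu>1 \<mu>2 \<longleftrightarrow> Im (\<mu>2 / \<mu>1) > 0 \<and>
     \<Gamma> = {of_int m * \<mu>1 + of_int n * \<mu>2 | m n. True}"

definition is_lattice :: "complex set \<Rightarrow> bool" where
  "is_lattice \<Gamma> \<longleftrightarrow> (\<exists>\<mu>1 \<mu>2. oriented_basis \<Gamma> \<mu>1 \<mu>2)"

definition shift :: "complex \<Rightarrow> pt \<Rightarrow> pt" where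
  "shift \<gamma> x = (fst x + \<gamma>, snd x)"

definition periodic_set :: "complex set \<Rightarrow> pt set \<Rightarrow> bool" where
  "periodic_set \<Gamma> V \<longleftrightarrow> (\<forall>\<gamma>\<in>\<Gamma>. \<forall>x\<in>V. shift \<gamma> x \<in> V)"

definition saturate :: "complex set \<Rightarrow> pt set \<Rightarrow> pt set" where
  "saturate \<Gamma> A = {shift \<gamma> x | \<gamma> x. \<gamma> \<in> \<Gamma> \<and> x \<in> A}"

text \<open>The preimage of \<open>M \<setminus> Z\<close> in the cover.\<close>

definition reg :: "complex set \<Rightarrow> pt set \<Rightarrow> pt set" where
  "reg \<Gamma> Z = - saturate \<Gamma> Z"

definition dir_x :: pt where "dir_x = (1, 0)"
definition dir_y :: pt where "dir_y = (\<i>, 0)"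
definition dir_t :: pt where "dir_t = (0, 1)"


section \<open>Monopoles\<close>

type_synonym 'r sect = "pt \<Rightarrow> complex^'r"

text \<open>
  A complex vector bundle of rank \<open>CARD('r)\<close> on \<open>M \<setminus> Z\<close>.  As sets, the fibres are identified
  with \<open>complex^'r\<close> (the same fibre over \<open>x\<close> and \<open>shift \<gamma> x\<close>) without any continuity; the smooth
  structure is carried only by the atlas \<open>frames\<close>, whose members \<open>(U, e)\<close> are an open subset
  \<open>U\<close> of \<open>M \<setminus> Z\<close> and a local frame, given by the columns of \<open>e x\<close>.  Hence the bundle need not be
  trivial.  \<open>conn M v s\<close> is the covariant derivative of the local section \<open>s\<close> along the constant
  vector field \<open>v\<close>.
\<close>

record ('r::finite) monopole =
  frames :: "(pt set \<times> (pt \<Rightarrow> complex^'r^'r)) set"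
  herm :: "pt \<Rightarrow> complex^'r \<Rightarrow> complex^'r \<Rightarrow> complex"
  conn :: "pt \<Rightarrow> 'r sect \<Rightarrow> 'r sect"
  higgs :: "pt \<Rightarrow> complex^'r^'r"

definition vector_bundle_atlas ::
  "complex set \<Rightarrow> pt set \<Rightarrow> (pt set \<times> (pt \<Rightarrow> complex^'r^'r::finite)) set \<Rightarrow> bool" where
  "vector_bundle_atlas \<Gamma> Z \<A> \<longleftrightarrow>
     \<Union>(fst ` \<A>) = reg \<Gamma> Z \<and>
     (\<forall>(U, e)\<in>\<A>. open U \<and> periodic_set \<Gamma> U \<and>
        (\<forall>x\<in>U. invertible (e x) \<and> (\<forall>\<gamma>\<in>\<Gamma>. e (shift \<gamma> x) = e x))) \<and>
     (\<forall>(U, e)\<in>\<A>. \<forall>(U', e')\<in>\<A>. smooth_on (U \<inter> U') (\<lambda>x. matrix_inv (e x) ** e' x))"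

text \<open>
  Sections over an open subset \<open>V\<close> of the cover, i.e. sections of the pulled back bundle; those
  that come from an open subset of \<open>M \<setminus> Z\<close> are the periodic ones.
\<close>

definition smooth_sect :: "'r::finite monopole \<Rightarrow> pt set \<Rightarrow> 'r sect \<Rightarrow> bool" where
  "smooth_sect M V s \<longleftrightarrow>
     (\<forall>(U, e)\<in>frames M. smooth_on (V \<inter> U) (\<lambda>x. matrix_inv (e x) *v s x))"

definition hermitian_metric :: "complex set \<Rightarrow> pt set \<Rightarrow> 'r::finite monopole \<Rightarrow> bool" where
  "hermitian_metric \<Gamma> Z M \<longleftrightarrow>
     (\<forall>x\<in>reg \<Gamma> Z.
        (\<forall>\<gamma>\<in>\<Gamma>. herm M (shift \<gamma> x) = herm M x) \<and>
        (\<forall>v v' w. herm M x (v + v') w = herm M x v w + herm M x v' w) \<and>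
        (\<forall>c v w. herm M x (c *s v) w = c * herm M x v w) \<and>
        (\<forall>v w. herm M x w v = cnj (herm M x v w)) \<and>
        (\<forall>v. v \<noteq> 0 \<longrightarrow> Re (herm M x v v) > 0)) \<and>
     (\<forall>V s t. open V \<and> V \<subseteq> reg \<Gamma> Z \<and> smooth_sect M V s \<and> smooth_sect M V t
        \<longrightarrow> smooth_on V (\<lambda>x. herm M x (s x) (t x)))"

definition hnorm :: "'r::finite monopole \<Rightarrow> pt \<Rightarrow> complex^'r \<Rightarrow> real" where
  "hnorm M x v = sqrt (Re (herm M x v v))"

definition connection :: "complex set \<Rightarrow> pt set \<Rightarrow> 'r::finite monopole \<Rightarrow> bool" where
  "connection \<Gamma> Z M \<longleftrightarrow>
     (\<forall>V. open V \<and> V \<subseteq> reg \<Gamma> Z \<longrightarrow>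
       (\<forall>s. smooth_sect M V s \<longrightarrow>
          (\<forall>v. smooth_sect M V (conn M v s)) \<and>
          (\<forall>s'. smooth_sect M V s' \<and> (\<forall>x\<in>V. s x = s' x) \<longrightarrow>
             (\<forall>v. \<forall>x\<in>V. conn M v s x = conn M v s' x)) \<and>
          (\<forall>v w (a::real) b. \<forall>x\<in>V.
             conn M (a *\<^sub>R v + b *\<^sub>R w) s x = a *\<^sub>R conn M v s x + b *\<^sub>R conn M w s x) \<and>
          (\<forall>s'. smooth_sect M V s' \<longrightarrow>
             (\<forall>v. \<forall>x\<in>V. conn M v (\<lambda>x. s x + s' x) x = conn M v s x + conn M v s' x)) \<and>
          (\<forall>f::pt \<Rightarrow> complex. smooth_on V f \<longrightarrow>
             (\<forall>v. \<forall>x\<in>V. conn M v (\<lambda>x. f x *s s x) x =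
                frechet_derivative f (at x) v *s s x + f x *s conn M v s x)) \<and>
          (\<forall>\<gamma>\<in>\<Gamma>. \<forall>v x. shift \<gamma> x \<in> V \<longrightarrow>
             conn M v (\<lambda>x. s (shift \<gamma> x)) x = conn M v s (shift \<gamma> x))))"

definition unitary_connection :: "complex set \<Rightarrow> pt set \<Rightarrow> 'r::finite monopole \<Rightarrow> bool" where
  "unitary_connection \<Gamma> Z M \<longleftrightarrow> connection \<Gamma> Z M \<and>
     (\<forall>V s t. open V \<and> V \<subseteq> reg \<Gamma> Z \<and> smooth_sect M V s \<and> smooth_sect M V t \<longrightarrow>
        (\<forall>v. \<forall>x\<in>V. frechet_derivative (\<lambda>x. herm M x (s x) (t x)) (at x) v =
           herm M x (conn M v s x) (t x) + herm M x (s x) (conn M v t x)))"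

definition anti_self_adjoint_endomorphism ::
  "complex set \<Rightarrow> pt set \<Rightarrow> 'r::finite monopole \<Rightarrow> bool" where
  "anti_self_adjoint_endomorphism \<Gamma> Z M \<longleftrightarrow>
     (\<forall>x\<in>reg \<Gamma> Z. (\<forall>\<gamma>\<in>\<Gamma>. higgs M (shift \<gamma> x) = higgs M x) \<and>
        (\<forall>v w. herm M x (higgs M x *v v) w = - herm M x v (higgs M x *v w))) \<and>
     (\<forall>V s. open V \<and> V \<subseteq> reg \<Gamma> Z \<and> smooth_sect M V s \<longrightarrow>
        smooth_sect M V (\<lambda>x. higgs M x *v s x))"

text \<open>\<open>F(\<nabla>)(v,w) s\<close> for constant, hence commuting, vector fields \<open>v\<close>, \<open>w\<close>, and \<open>(\<nabla>\<^sub>v \<phi>) s\<close>.\<close>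

definition curvature :: "'r::finite monopole \<Rightarrow> pt \<Rightarrow> pt \<Rightarrow> 'r sect \<Rightarrow> 'r sect" where
  "curvature M v w s x = conn M v (conn M w s) x - conn M w (conn M v s) x"

definition dhiggs :: "'r::finite monopole \<Rightarrow> pt \<Rightarrow> 'r sect \<Rightarrow> 'r sect" where
  "dhiggs M v s x = conn M v (\<lambda>x. higgs M x *v s x) x - higgs M x *v conn M v s x"

text \<open>
  With \<open>z = x + \<i> y\<close>, the orientation \<open>(\<i>/2) dz \<and> d\<bar>z \<and> dy\<^sub>0\<close> is \<open>dx \<and> dy \<and> dy\<^sub>0\<close>, so the Hodge
  star sends \<open>dx, dy, dy\<^sub>0\<close> to \<open>dy \<and> dy\<^sub>0, dy\<^sub>0 \<and> dx, dx \<and> dy\<close>.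
\<close>

definition bogomolny :: "complex set \<Rightarrow> pt set \<Rightarrow> 'r::finite monopole \<Rightarrow> bool" where
  "bogomolny \<Gamma> Z M \<longleftrightarrow>
     (\<forall>V s. open V \<and> V \<subseteq> reg \<Gamma> Z \<and> smooth_sect M V s \<longrightarrow> (\<forall>x\<in>V.
        curvature M dir_y dir_t s x = dhiggs M dir_x s x \<and>
        curvature M dir_t dir_x s x = dhiggs M dir_y s x \<and>
        curvature M dir_x dir_y s x = dhiggs M dir_t s x))"

definition monopole_on :: "complex set \<Rightarrow> pt set \<Rightarrow> 'r::finite monopole \<Rightarrow> bool" where
  "monopole_on \<Gamma> Z M \<longleftrightarrow>
     vector_bundle_atlas \<Gamma> Z (frames M) \<and> hermitian_metric \<Gamma> Z M \<and>
     unitary_connection \<Gamma> Z M \<and> anti_self_adjoint_endomorphism \<Gamma> Z M \<and> bogomolny \<Gamma> Z M"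

subsection \<open>Dirac type singularities\<close>

text \<open>
  The Hopf map \<open>\<complex>\<^sup>2 \<rightarrow> \<complex> \<times> \<real>\<close>, centred at \<open>x0\<close>, invariant under
  \<open>(u\<^sub>1, u\<^sub>2) \<mapsto> (exp (\<i>\<theta>) u\<^sub>1, exp (-\<i>\<theta>) u\<^sub>2)\<close>.
\<close>

definition hopf :: "pt \<Rightarrow> complex \<times> complex \<Rightarrow> pt" where
  "hopf x0 u = x0 + (2 * fst u * snd u, (cmod (fst u))\<^sup>2 - (cmod (snd u))\<^sup>2)"

text \<open>
  The invariant one-form for which \<open>H\<^sup>*\<nabla> + H\<^sup>*\<phi> \<otimes> \<xi>\<close> is anti-self-dual (for the standard
  orientation of \<open>\<complex>\<^sup>2\<close>) exactly when \<open>F(\<nabla>) = \<star>\<nabla>\<phi>\<close>; the factor and the sign are forced by this.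
\<close>

definition hopf_form :: "complex \<times> complex \<Rightarrow> complex \<times> complex \<Rightarrow> real" where
  "hopf_form u w = 2 * Im (cnj (snd u) * snd w) - 2 * Im (cnj (fst u) * fst w)"

definition frame_deriv ::
  "'r::finite monopole \<Rightarrow> (pt \<Rightarrow> complex^'r^'r) \<Rightarrow> pt \<Rightarrow> pt \<Rightarrow> complex^'r^'r" where
  "frame_deriv M e v x = (\<chi> i j. conn M v (\<lambda>x. column j (e x)) x $ i)"

text \<open>
  Smooth extension over the origin of \<open>H\<^sup>*E\<close> with its metric and the connection
  \<open>H\<^sup>*\<nabla> + H\<^sup>*\<phi> \<otimes> \<xi>\<close>: on a punctured ball there is a smooth frame \<open>g\<close> of \<open>H\<^sup>*E\<close> (written
  \<open>(e \<circ> H) ** G\<close> in terms of a frame \<open>e\<close> of \<open>E\<close>) in which the connection form \<open>a\<close> and the Gram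
  matrix \<open>k\<close> of the metric extend smoothly to the ball, the latter as a metric.
\<close>

definition dirac_type :: "complex set \<Rightarrow> pt set \<Rightarrow> 'r::finite monopole \<Rightarrow> pt \<Rightarrow> bool" where
  "dirac_type \<Gamma> Z M x0 \<longleftrightarrow>
     (\<exists>\<delta>>0. \<exists>(g :: complex \<times> complex \<Rightarrow> complex^'r^'r)
             (a :: complex \<times> complex \<Rightarrow> complex \<times> complex \<Rightarrow> complex^'r^'r)
             (k :: complex \<times> complex \<Rightarrow> complex^'r^'r).
        hopf x0 ` (ball 0 \<delta> - {0}) \<subseteq> reg \<Gamma> Z \<and>
        (\<forall>u\<in>ball 0 \<delta> - {0}. invertible (g u)) \<and>
        (\<forall>w. smooth_on (ball 0 \<delta>) (a w)) \<and>
        smooth_on (ball 0 \<delta>) k \<and>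
        (\<forall>u\<in>ball 0 \<delta> - {0}. \<forall>i j. k u $ i $ j = herm M (hopf x0 u) (column i (g u)) (column j (g u))) \<and>
        (\<forall>c::complex^'r. c \<noteq> 0 \<longrightarrow> Re (\<Sum>i\<in>UNIV. \<Sum>j\<in>UNIV. c $ i * k 0 $ i $ j * cnj (c $ j)) > 0) \<and>
        (\<forall>(U, e)\<in>frames M.
           let B = {u \<in> ball 0 \<delta> - {0}. hopf x0 u \<in> U};
               G = (\<lambda>u. matrix_inv (e (hopf x0 u)) ** g u)
           in smooth_on B G \<and>
              (\<forall>u\<in>B. \<forall>w.
                 g u ** a w u =
                   e (hopf x0 u) ** frechet_derivative G (at u) w
                   + frame_deriv M e (frechet_derivative (hopf x0) (at u) w) (hopf x0 u) ** G u
                   + hopf_form u w *\<^sub>R (higgs M (hopf x0 u) ** g u))))"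

text \<open>
  Boundedness of \<open>F(\<nabla>)\<close> is expressed by its action on sections.  The compact subset of
  \<open>(\<complex>/\<Gamma>) \<times> \<real>\<close> is the image of a compact subset \<open>K\<close> of the cover.
\<close>

definition meromorphic_monopole :: "complex set \<Rightarrow> pt set \<Rightarrow> 'r::finite monopole \<Rightarrow> bool" where
  "meromorphic_monopole \<Gamma> Z M \<longleftrightarrow>
     monopole_on \<Gamma> Z M \<and>
     (\<forall>x0\<in>saturate \<Gamma> Z. dirac_type \<Gamma> Z M x0) \<and>
     (\<exists>K B. compact K \<and> Z \<subseteq> saturate \<Gamma> K \<and>
        (\<forall>V s. open V \<and> V \<subseteq> reg \<Gamma> Z \<and> smooth_sect M V s \<longrightarrow>
          (\<forall>x\<in>V - saturate \<Gamma> K. \<forall>v\<in>{dir_x, dir_y, dir_t}. \<forall>w\<in>{dir_x, dir_y, dir_t}.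
             hnorm M x (curvature M v w s x) \<le> B * hnorm M x (s x))))"


section \<open>Coordinates and the choice of the basis\<close>

definition alpha_coord :: "complex \<Rightarrow> pt \<Rightarrow> complex" where
  "alpha_coord lam x = (fst x + lam\<^sup>2 * cnj (fst x) - 2 * \<i> * lam * of_real (snd x)) / of_real (1 + (cmod lam)\<^sup>2)"

definition tau_coord :: "complex \<Rightarrow> pt \<Rightarrow> real" where
  "tau_coord lam x = ((1 - (cmod lam)\<^sup>2) * snd x + 2 * Im (cnj lam * fst x)) / (1 + (cmod lam)\<^sup>2)"

text \<open>The constant vector fields dual to the linear coordinates \<open>(Re \<alpha>, Im \<alpha>, \<tau>)\<close>.\<close>

definition coord_field :: "complex \<Rightarrow> complex \<times> real \<Rightarrow> pt" where
  "coord_field lam = inv (\<lambda>x. (alpha_coord lam x, tau_coord lam x))"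

text \<open>The coordinate map is an isometry for every \<open>lam\<close>, so \<open>inv\<close> is its true inverse.\<close>

lemma coord_field_eq:
  "coord_field lam (a, t) =
     ((a + lam\<^sup>2 * cnj a + 2 * \<i> * lam * of_real t) / of_real (1 + (cmod lam)\<^sup>2),
      (2 * Re (\<i> * cnj lam * a) + (1 - (cmod lam)\<^sup>2) * t) / (1 + (cmod lam)\<^sup>2))"
proof -
  obtain l m where lm: "lam = Complex l m" by (cases lam)
  define n where "n = 1 + (l\<^sup>2 + m\<^sup>2)"
  have n0: "n \<noteq> 0"
    unfolding n_def by (smt (verit) sum_power2_ge_zero)
  have n1: "(cmod lam)\<^sup>2 = l\<^sup>2 + m\<^sup>2"
    by (simp add: lm cmod_power2)
  define L where "L = (\<lambda>x. (alpha_coord lam x, tau_coord lam x))"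
  define R where "R = (\<lambda>(a, t). ((a + lam\<^sup>2 * cnj a + 2 * \<i> * lam * of_real t) / of_real n,
      (2 * Re (\<i> * cnj lam * a) + (1 - (cmod lam)\<^sup>2) * t) / n))"
  have L_eq: "L (Complex x y, s) =
      (Complex ((x + (l\<^sup>2 - m\<^sup>2) * x + 2 * l * m * y + 2 * m * s) / n)
               ((y + 2 * l * m * x - (l\<^sup>2 - m\<^sup>2) * y - 2 * l * s) / n),
       ((1 - l\<^sup>2 - m\<^sup>2) * s + 2 * (l * y - m * x)) / n)" for x y s
    unfolding L_def alpha_coord_def tau_coord_def n1 n_def[symmetric]
    by (simp add: complex_eq_iff lm Re_divide_of_real Im_divide_of_real Re_power2 Im_power2 algebra_simps)
  have R_eq: "R (Complex x y, s) =
      (Complex ((x + (l\<^sup>2 - m\<^sup>2) * x + 2 * l * m * y - 2 * m * s) / n)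
               ((y + 2 * l * m * x - (l\<^sup>2 - m\<^sup>2) * y + 2 * l * s) / n),
       ((1 - l\<^sup>2 - m\<^sup>2) * s + 2 * (m * x - l * y)) / n)" for x y s
    unfolding R_def n1
    by (simp add: complex_eq_iff lm Re_divide_of_real Im_divide_of_real Re_power2 Im_power2 algebra_simps)
  have div: "A / n = t" if "n * A = n * n * t" for A t :: real
    using that n0 by (simp add: field_simps)
  have LR: "L (R (b, s)) = (b, s)" for b s
  proof (cases b)
    case (Complex x y)
    define X where "X = (x + (l\<^sup>2 - m\<^sup>2) * x + 2 * l * m * y - 2 * m * s) / n"
    define Y where "Y = (y + 2 * l * m * x - (l\<^sup>2 - m\<^sup>2) * y + 2 * l * s) / n"
    define S where "S = ((1 - l\<^sup>2 - m\<^sup>2) * s + 2 * (m * x - l * y)) / n"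
    have e: "n * X = x + (l\<^sup>2 - m\<^sup>2) * x + 2 * l * m * y - 2 * m * s"
      "n * Y = y + 2 * l * m * x - (l\<^sup>2 - m\<^sup>2) * y + 2 * l * s"
      "n * S = (1 - l\<^sup>2 - m\<^sup>2) * s + 2 * (m * x - l * y)"
      using n0 by (simp_all add: X_def Y_def S_def)
    have k0: "(X + (l\<^sup>2 - m\<^sup>2) * X + 2 * l * m * Y + 2 * m * S) / n = x"
    proof -
      have "n * (X + (l\<^sup>2 - m\<^sup>2) * X + 2 * l * m * Y + 2 * m * S) = (n * X) + (l\<^sup>2 - m\<^sup>2) * (n * X) + 2 * l * m * (n * Y) + 2 * m * (n * S)"
        by (simp add: algebra_simps)
      also have "\<dots> = n * n * x"
        unfolding e unfolding n_def by (simp add: algebra_simps power2_eq_square)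
      finally show ?thesis by (rule div)
    qed
    have k1: "(Y + 2 * l * m * X - (l\<^sup>2 - m\<^sup>2) * Y - 2 * l * S) / n = y"
    proof -
      have "n * (Y + 2 * l * m * X - (l\<^sup>2 - m\<^sup>2) * Y - 2 * l * S) = (n * Y) + 2 * l * m * (n * X) - (l\<^sup>2 - m\<^sup>2) * (n * Y) - 2 * l * (n * S)"
        by (simp add: algebra_simps)
      also have "\<dots> = n * n * y"
        unfolding e unfolding n_def by (simp add: algebra_simps power2_eq_square)
      finally show ?thesis by (rule div)
    qed
    have k2: "((1 - l\<^sup>2 - m\<^sup>2) * S + 2 * (l * Y - m * X)) / n = s"
    proof -
      have "n * ((1 - l\<^sup>2 - m\<^sup>2) * S + 2 * (l * Y - m * X)) = (1 - l\<^sup>2 - m\<^sup>2) * (n * S) + 2 * (l * (n * Y) - m * (n * X))"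
        by (simp add: algebra_simps)
      also have "\<dots> = n * n * s"
        unfolding e unfolding n_def by (simp add: algebra_simps power2_eq_square)
      finally show ?thesis by (rule div)
    qed
    show ?thesis
      unfolding Complex R_eq L_eq X_def[symmetric] Y_def[symmetric] S_def[symmetric]
      k0 k1 k2 by (rule refl)
  qed
  have RL: "R (L x) = x" for x
  proof -
    obtain x1 y s where x: "x = (Complex x1 y, s)" by (cases x; cases "fst x") auto
    define X where "X = (x1 + (l\<^sup>2 - m\<^sup>2) * x1 + 2 * l * m * y + 2 * m * s) / n"
    define Y where "Y = (y + 2 * l * m * x1 - (l\<^sup>2 - m\<^sup>2) * y - 2 * l * s) / n"
    define S where "S = ((1 - l\<^sup>2 - m\<^sup>2) * s + 2 * (l * y - m * x1)) / n"
    have e: "n * X = x1 + (l\<^sup>2 - m\<^sup>2) * x1 + 2 * l * m * y + 2 * m * s"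
      "n * Y = y + 2 * l * m * x1 - (l\<^sup>2 - m\<^sup>2) * y - 2 * l * s"
      "n * S = (1 - l\<^sup>2 - m\<^sup>2) * s + 2 * (l * y - m * x1)"
      using n0 by (simp_all add: X_def Y_def S_def)
    have k0: "(X + (l\<^sup>2 - m\<^sup>2) * X + 2 * l * m * Y - 2 * m * S) / n = x1"
    proof -
      have "n * (X + (l\<^sup>2 - m\<^sup>2) * X + 2 * l * m * Y - 2 * m * S) = (n * X) + (l\<^sup>2 - m\<^sup>2) * (n * X) + 2 * l * m * (n * Y) - 2 * m * (n * S)"
        by (simp add: algebra_simps)
      also have "\<dots> = n * n * x1"
        unfolding e unfolding n_def by (simp add: algebra_simps power2_eq_square)
      finally show ?thesis by (rule div)
    qed
    have k1: "(Y + 2 * l * m * X - (l\<^sup>2 - m\<^sup>2) * Y + 2 * l * S) / n = y"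
    proof -
      have "n * (Y + 2 * l * m * X - (l\<^sup>2 - m\<^sup>2) * Y + 2 * l * S) = (n * Y) + 2 * l * m * (n * X) - (l\<^sup>2 - m\<^sup>2) * (n * Y) + 2 * l * (n * S)"
        by (simp add: algebra_simps)
      also have "\<dots> = n * n * y"
        unfolding e unfolding n_def by (simp add: algebra_simps power2_eq_square)
      finally show ?thesis by (rule div)
    qed
    have k2: "((1 - l\<^sup>2 - m\<^sup>2) * S + 2 * (m * X - l * Y)) / n = s"
    proof -
      have "n * ((1 - l\<^sup>2 - m\<^sup>2) * S + 2 * (m * X - l * Y)) = (1 - l\<^sup>2 - m\<^sup>2) * (n * S) + 2 * (m * (n * X) - l * (n * Y))"
        by (simp add: algebra_simps)
      also have "\<dots> = n * n * s"
        unfolding e unfolding n_def by (simp add: algebra_simps power2_eq_square)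
      finally show ?thesis by (rule div)
    qed
    show ?thesis
      unfolding x L_eq R_eq X_def[symmetric] Y_def[symmetric] S_def[symmetric]
      k0 k1 k2 by (rule refl)
  qed
  have "inv L = R"
    using LR RL by (intro inv_unique_comp) (auto simp: fun_eq_iff)
  then have "inv L (a, t) = R (a, t)" by simp
  then show ?thesis
    unfolding coord_field_def L_def R_def n_def n1 by simp
qed

text \<open>The projection to \<open>T\<^sup>\<lambda> = \<complex>/T_lattice\<close>; points and subsets of \<open>T\<^sup>\<lambda>\<close> are lifted to \<open>\<complex>\<close>.\<close>

definition T_lattice :: "complex \<Rightarrow> complex set \<Rightarrow> complex set" where
  "T_lattice lam \<Gamma> = (\<lambda>\<gamma>. \<gamma> + lam\<^sup>2 * cnj \<gamma>) ` \<Gamma>"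

definition T_open :: "complex \<Rightarrow> complex set \<Rightarrow> complex set \<Rightarrow> bool" where
  "T_open lam \<Gamma> W \<longleftrightarrow> open W \<and> (\<forall>l\<in>T_lattice lam \<Gamma>. \<forall>P\<in>W. P + l \<in> W)"

definition proj :: "complex \<Rightarrow> pt \<Rightarrow> complex" where
  "proj lam x = fst x + lam\<^sup>2 * cnj (fst x) - 2 * \<i> * lam * of_real (snd x)"

record choice =
  mu1 :: complex
  mu2 :: complex
  s1 :: real
  g1 :: complex

definition admissible :: "complex set \<Rightarrow> complex \<Rightarrow> choice \<Rightarrow> bool" where
  "admissible \<Gamma> lam C \<longleftrightarrow>
     oriented_basis \<Gamma> (mu1 C) (mu2 C) \<and> cmod (g1 C) = 1 \<and>
     - lam * cnj (mu1 C) + of_real (s1 C) = g1 C * (mu1 C + lam * of_real (s1 C)) \<and>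
     g1 C * (mu1 C + lam * of_real (s1 C)) \<noteq> 0"

definition u_coord :: "complex \<Rightarrow> choice \<Rightarrow> pt \<Rightarrow> complex" where
  "u_coord lam C x = of_real (1 + (cmod lam)\<^sup>2) / (1 - g1 C * lam) * alpha_coord lam x"

definition tt_coord :: "complex \<Rightarrow> choice \<Rightarrow> pt \<Rightarrow> real" where
  "tt_coord lam C x =
     Im ((- g1 C * fst x - lam * cnj (fst x) + \<i> * (1 + g1 C * lam) * of_real (snd x)) / (1 - g1 C * lam))"

definition q_lam :: "complex \<Rightarrow> choice \<Rightarrow> complex" where
  "q_lam lam C = exp (2 * pi * \<i> * (mu2 C + lam\<^sup>2 * cnj (mu2 C)) / (mu1 C + lam\<^sup>2 * cnj (mu1 C)))"

text \<open>\<open>Im (cnj \<mu>\<^sub>1 * \<mu>\<^sub>2)\<close> is the area of \<open>\<complex>/\<Gamma>\<close>, positive for an oriented basis.\<close>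

definition t_lam :: "choice \<Rightarrow> real" where
  "t_lam C = - Im (cnj (mu1 C) * mu2 C) / Re (g1 C * mu1 C)"

text \<open>The coordinates \<open>(y, t)\<close> on \<open>\<complex>\<^sup>* \<times> \<real>\<close>, pulled back to \<open>\<complex> \<times> \<real>\<close>.\<close>

definition y_coord :: "complex \<Rightarrow> choice \<Rightarrow> pt \<Rightarrow> complex" where
  "y_coord lam C x = exp (2 * pi * \<i> / (mu1 C + lam * of_real (s1 C)) * u_coord lam C x)"

definition t_coord :: "complex \<Rightarrow> choice \<Rightarrow> pt \<Rightarrow> real" where
  "t_coord lam C x = tt_coord lam C x / t_lam C"

definition f_fun :: "complex \<Rightarrow> choice \<Rightarrow> pt \<Rightarrow> real" where
  "f_fun lam C x = t_coord lam C x - ln (cmod (y_coord lam C x)) / ln (cmod (q_lam lam C))"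


section \<open>Filtered objects on the elliptic curve\<close>

datatype side = Plus | Minus

fun opp :: "side \<Rightarrow> side" where
  "opp Plus = Minus"
| "opp Minus = Plus"

text \<open>
  The data of a locally free module on \<open>T\<^sup>\<lambda>\<close> with parabolic structure, as realised below:
  \<^item> \<open>fo_sections W\<close> are the sections over the open set \<open>W\<close>, each one a function on the
    three-manifold, so that the module operations are the pointwise ones;
  \<^item> \<open>fo_points P\<close> is \<open>s\<^sub>P\<^sub>,\<^sub>1 < \<dots> < s\<^sub>P\<^sub>,\<^sub>m\<close> and \<open>fo_lattices P\<close> is \<open>K\<^sub>P\<^sub>,\<^sub>0, \<dots>, K\<^sub>P\<^sub>,\<^sub>m\<close> (both empty if \<open>P\<close> is not
    in \<open>fo_divisor\<close>); an element of the formal completion is an equivalence class of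
    Cauchy sequences of germs;
  \<^item> \<open>fo_filt\<close> and \<open>fo_gr_filt\<close> are the two filtrations, given in the fibre at each point \<open>Q\<close>.
    A vector of the fibre is a class of sections modulo the maximal ideal at \<open>Q\<close>, and an
    element of \<open>Gr\<^sub>\<mu>\<close> is a coset, i.e. a set of such classes.
\<close>

record ('r::finite) filtered_object =
  fo_divisor :: "complex set"
  fo_sections :: "complex set \<Rightarrow> 'r sect set"
  fo_points :: "complex \<Rightarrow> real list"
  fo_lattices :: "complex \<Rightarrow> (nat \<Rightarrow> 'r sect) set set list"
  fo_filt :: "side \<Rightarrow> complex \<Rightarrow> rat \<Rightarrow> 'r sect set set"
  fo_gr_filt :: "side \<Rightarrow> complex \<Rightarrow> rat \<Rightarrow> real \<Rightarrow> 'r sect set set set"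

text \<open>The functor \<open>H\<close>; only \<open>c \<noteq> 0\<close> is meaningful.\<close>

definition rescale :: "real \<Rightarrow> 'r::finite filtered_object \<Rightarrow> 'r filtered_object" where
  "rescale c H = (if c > 0 then
     \<lparr> fo_divisor = fo_divisor H,
       fo_sections = fo_sections H,
       fo_points = (\<lambda>P. map (\<lambda>s. c * s) (fo_points H P)),
       fo_lattices = fo_lattices H,
       fo_filt = fo_filt H,
       fo_gr_filt = (\<lambda>sd Q \<mu> b. fo_gr_filt H sd Q \<mu> (b / c)) \<rparr>
   else
     \<lparr> fo_divisor = fo_divisor H,
       fo_sections = fo_sections H,
       fo_points = (\<lambda>P. rev (map (\<lambda>s. c * s) (fo_points H P))),
       fo_lattices = (\<lambda>P. rev (fo_lattices H P)),
       fo_filt = (\<lambda>sd. fo_filt H (opp sd)),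
       fo_gr_filt = (\<lambda>sd Q \<mu> b. fo_gr_filt H (opp sd) Q \<mu> (b / \<bar>c\<bar>)) \<rparr>)"


section \<open>The filtered object of a meromorphic monopole\<close>

context
  fixes \<Gamma> :: "complex set" and Z :: "pt set" and M :: "'r::finite monopole" and lam :: complex
begin

text \<open>\<open>\<nabla>\<close> along \<open>\<partial>/\<partial>\<bar>\<alpha> = (\<partial>/\<partial>(Re \<alpha>) + \<i> \<partial>/\<partial>(Im \<alpha>))/2\<close> and along \<open>\<partial>/\<partial>\<tau>\<close>.\<close>

definition nabla_alpha_bar :: "'r sect \<Rightarrow> 'r sect" where
  "nabla_alpha_bar s x = (1/2) *s (conn M (coord_field lam (1, 0)) s x
                                   + \<i> *s conn M (coord_field lam (\<i>, 0)) s x)"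

definition nabla_tau :: "'r sect \<Rightarrow> 'r sect" where
  "nabla_tau s = conn M (coord_field lam (0, 1)) s"

text \<open>Sections of the sheaf \<open>\<E>\<close> over \<open>V\<close>; this is also \<open>\<VV>\<close> away from the ends of the manifold.\<close>

definition minihol :: "pt set \<Rightarrow> 'r sect \<Rightarrow> bool" where
  "minihol V s \<longleftrightarrow> smooth_sect M V s \<and>
     (\<forall>x\<in>V. nabla_alpha_bar s x = 0 \<and> nabla_tau s x - \<i> *s (higgs M x *v s x) = 0)"

definition divisor :: "complex set" where
  "divisor = proj lam ` saturate \<Gamma> Z"

text \<open>
  The germ of \<open>s\<close> at \<open>x0\<close> (\<open>s\<close> being defined off the preimage of the divisor) lies in the stalk of
  \<open>\<VV>\<close> at \<open>x0\<close> times the \<open>n\<close>-th power of the maximal ideal at \<open>proj lam x0\<close>.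
\<close>

definition in_stalk :: "nat \<Rightarrow> pt \<Rightarrow> 'r sect \<Rightarrow> bool" where
  "in_stalk n x0 s \<longleftrightarrow> (\<exists>V \<sigma>. open V \<and> x0 \<in> V \<and> V \<subseteq> reg \<Gamma> Z \<and> minihol V \<sigma> \<and>
     (\<forall>x\<in>V. proj lam x \<notin> divisor \<longrightarrow> s x = (proj lam x - proj lam x0) ^ n *s \<sigma> x))"

text \<open>
  The restriction of \<open>s\<close> to the slice \<open>t = t x0\<close> is near \<open>x0\<close> a section of
  \<open>\<VV>\<close> restricted to this slice, with a pole of arbitrary order allowed at \<open>y = y x0\<close>.
\<close>

definition slice_meromorphic :: "choice \<Rightarrow> pt \<Rightarrow> 'r sect \<Rightarrow> bool" where
  "slice_meromorphic C x0 s \<longleftrightarrow>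
     (\<exists>(n::nat) V \<sigma>. open V \<and> x0 \<in> V \<and> V \<subseteq> reg \<Gamma> Z \<and> minihol V \<sigma> \<and>
       (\<forall>x\<in>V. t_coord lam C x = t_coord lam C x0 \<and> y_coord lam C x \<noteq> y_coord lam C x0 \<longrightarrow>
          (y_coord lam C x - y_coord lam C x0) ^ n *s s x = \<sigma> x))"

text \<open>
  Sections over \<open>W\<close> of the module on \<open>T\<^sup>\<lambda>\<close>.  Off the divisor they are the sections of \<open>\<VV>\<close> over the
  whole preimage, which are invariant under scattering by definition.  Over a point of the divisor
  the condition is imposed on every slice through a point \<open>x0 = (\<alpha>\<^sub>P, t\<^sub>P)\<close> outside \<open>Z\<close>; since
  scattering is meromorphic, each single \<open>t\<^sub>P\<close> gives the same module.  Sections are normalised to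
  vanish where they are not defined, so that equality of functions is equality of sections.
\<close>

definition E_tilde :: "choice \<Rightarrow> complex set \<Rightarrow> 'r sect set" where
  "E_tilde C W = {s. T_open lam \<Gamma> W \<and>
     minihol {x. proj lam x \<in> W - divisor} s \<and>
     (\<forall>\<gamma>\<in>\<Gamma>. \<forall>x. s (shift \<gamma> x) = s x) \<and>
     (\<forall>x. proj lam x \<notin> W - divisor \<longrightarrow> s x = 0) \<and>
     (\<forall>x0\<in>reg \<Gamma> Z. proj lam x0 \<in> W \<inter> divisor \<longrightarrow> slice_meromorphic C x0 s)}"

definition E_tilde_near :: "choice \<Rightarrow> complex \<Rightarrow> 'r sect set" where
  "E_tilde_near C P = \<Union>(E_tilde C ` {W. P \<in> W})"

text \<open>
  The formal completion at \<open>P\<close>: the stalk completed for the topology given by the powers of the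
  maximal ideal times a lattice.  The stalks of \<open>\<VV>\<close> at the points \<open>x0\<close> over \<open>P\<close> are lattices, and
  they all define the same topology.
\<close>

definition adic_Cauchy :: "choice \<Rightarrow> complex \<Rightarrow> (nat \<Rightarrow> 'r sect) \<Rightarrow> bool" where
  "adic_Cauchy C P S \<longleftrightarrow> (\<forall>k. S k \<in> E_tilde_near C P) \<and>
     (\<forall>x0\<in>reg \<Gamma> Z. proj lam x0 = P \<longrightarrow>
        (\<forall>n. \<exists>N. \<forall>k\<ge>N. \<forall>l\<ge>N. in_stalk n x0 (\<lambda>x. S k x - S l x)))"

definition formal_class :: "choice \<Rightarrow> complex \<Rightarrow> (nat \<Rightarrow> 'r sect) \<Rightarrow> (nat \<Rightarrow> 'r sect) set" where
  "formal_class C P S = {S'. adic_Cauchy C P S' \<and>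
     (\<forall>x0\<in>reg \<Gamma> Z. proj lam x0 = P \<longrightarrow>
        (\<forall>n. \<exists>N. \<forall>k\<ge>N. in_stalk n x0 (\<lambda>x. S k x - S' k x)))}"

definition par_points :: "choice \<Rightarrow> complex \<Rightarrow> real list" where
  "par_points C P = sorted_list_of_set (f_fun lam C ` {x \<in> saturate \<Gamma> Z. proj lam x = P})"

text \<open>
  The completed stalk, inside the formal completion at \<open>P\<close>, of \<open>\<VV>\<close> at a point \<open>x\<close> over \<open>P\<close> with
  \<open>s\<^sub>P\<^sub>,\<^sub>i < f x < s\<^sub>P\<^sub>,\<^sub>i\<^sub>+\<^sub>1\<close>; the stalks at all these points agree by flat transport.  The list
  \<open>par_points C P\<close> is indexed from \<open>0\<close>.
\<close>

definition completed_stalk :: "choice \<Rightarrow> complex \<Rightarrow> nat \<Rightarrow> (nat \<Rightarrow> 'r sect) set set" where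
  "completed_stalk C P i = {formal_class C P S | S. adic_Cauchy C P S \<and>
     (\<forall>k. \<forall>x\<in>reg \<Gamma> Z. proj lam x = P \<and>
        (i > 0 \<longrightarrow> par_points C P ! (i - 1) < f_fun lam C x) \<and>
        (i < length (par_points C P) \<longrightarrow> f_fun lam C x < par_points C P ! i)
        \<longrightarrow> in_stalk 0 x (S k))}"

definition par_lattices :: "choice \<Rightarrow> complex \<Rightarrow> (nat \<Rightarrow> 'r sect) set set list" where
  "par_lattices C P = (if P \<in> divisor
     then map (completed_stalk C P) [0..<Suc (length (par_points C P))] else [])"

text \<open>The lattices \<open>E\<^sub>-\<close> and \<open>E\<^sub>+\<close> determined by all \<open>K\<^sub>P\<^sub>,\<^sub>0\<close>, respectively all \<open>K\<^sub>P\<^sub>,\<^sub>m\<^sub>(\<^sub>P\<^sub>)\<close>.\<close>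

fun end_lattice :: "side \<Rightarrow> choice \<Rightarrow> complex \<Rightarrow> (nat \<Rightarrow> 'r sect) set set" where
  "end_lattice Minus C P = hd (par_lattices C P)"
| "end_lattice Plus C P = last (par_lattices C P)"

definition E_end :: "side \<Rightarrow> choice \<Rightarrow> complex set \<Rightarrow> 'r sect set" where
  "E_end sd C W = {s \<in> E_tilde C W. \<forall>P\<in>W \<inter> divisor. formal_class C P (\<lambda>_. s) \<in> end_lattice sd C P}"

definition E_end_near :: "side \<Rightarrow> choice \<Rightarrow> complex \<Rightarrow> 'r sect set" where
  "E_end_near sd C Q = \<Union>(E_end sd C ` {W. Q \<in> W})"

text \<open>The germ of \<open>\<sigma>\<close> at \<open>Q\<close> lies in the maximal ideal times the stalk of \<open>E\<^sub>\<plusminus>\<close>.\<close>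

definition vanishes_at :: "side \<Rightarrow> choice \<Rightarrow> complex \<Rightarrow> 'r sect \<Rightarrow> bool" where
  "vanishes_at sd C Q \<sigma> \<longleftrightarrow> (\<exists>\<rho>\<in>E_end_near sd C Q. \<exists>N. open N \<and> Q \<in> N \<and>
     (\<forall>x. proj lam x \<in> N - divisor \<longrightarrow> \<sigma> x = (proj lam x - Q) *s \<rho> x))"

definition fibre_class :: "side \<Rightarrow> choice \<Rightarrow> complex \<Rightarrow> 'r sect \<Rightarrow> 'r sect set" where
  "fibre_class sd C Q \<sigma> = {\<sigma>' \<in> E_end_near sd C Q. vanishes_at sd C Q (\<lambda>x. \<sigma> x - \<sigma>' x)}"

text \<open>
  The flat extension along the line over \<open>Q\<close> of the fibre vector represented by \<open>\<sigma>\<close>: if \<open>Q\<close> lies in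
  the divisor, \<open>\<sigma>\<close> extends (uniquely) to a section of \<open>\<VV>\<close> at the points \<open>x0\<close> over \<open>Q\<close> that are close to
  the end in question.
\<close>

definition flat_ext :: "'r sect \<Rightarrow> 'r sect" where
  "flat_ext \<sigma> x0 = (THE v. \<exists>V \<rho>. open V \<and> x0 \<in> V \<and> V \<subseteq> reg \<Gamma> Z \<and> minihol V \<rho> \<and>
     (\<forall>x\<in>V. proj lam x \<notin> divisor \<longrightarrow> \<sigma> x = \<rho> x) \<and> v = \<rho> x0)"

fun end_filter :: "side \<Rightarrow> choice \<Rightarrow> complex \<Rightarrow> pt filter" where
  "end_filter Plus C Q = inf (filtercomap (f_fun lam C) at_top) (principal {x. proj lam x = Q})"
| "end_filter Minus C Q = inf (filtercomap (f_fun lam C) at_bot) (principal {x. proj lam x = Q})"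

definition log_abs_q :: "choice \<Rightarrow> real" where
  "log_abs_q C = \<bar>ln (cmod (q_lam lam C))\<bar>"

definition growth_F :: "side \<Rightarrow> choice \<Rightarrow> complex \<Rightarrow> rat \<Rightarrow> 'r sect \<Rightarrow> bool" where
  "growth_F sd C Q \<mu> \<sigma> \<longleftrightarrow> (\<forall>\<epsilon>>0. (\<lambda>x. hnorm M x (flat_ext \<sigma> x)) \<in> O[end_filter sd C Q](\<lambda>x.
     exp ((of_rat \<mu> / 2 * log_abs_q C + \<epsilon>) * (f_fun lam C x)\<^sup>2)))"

definition growth_Gr :: "side \<Rightarrow> choice \<Rightarrow> complex \<Rightarrow> rat \<Rightarrow> real \<Rightarrow> 'r sect \<Rightarrow> bool" where
  "growth_Gr sd C Q \<mu> b \<sigma> \<longleftrightarrow> (\<forall>\<epsilon>>0. (\<lambda>x. hnorm M x (flat_ext \<sigma> x)) \<in> O[end_filter sd C Q](\<lambda>x.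
     exp (of_rat \<mu> / 2 * log_abs_q C * (f_fun lam C x)\<^sup>2 + (b + \<epsilon>) * log_abs_q C * \<bar>f_fun lam C x\<bar>)))"

definition filt :: "side \<Rightarrow> choice \<Rightarrow> complex \<Rightarrow> rat \<Rightarrow> 'r sect set set" where
  "filt sd C Q \<mu> = {fibre_class sd C Q \<sigma> | \<sigma>. \<sigma> \<in> E_end_near sd C Q \<and> growth_F sd C Q \<mu> \<sigma>}"

definition gr_class :: "side \<Rightarrow> choice \<Rightarrow> complex \<Rightarrow> rat \<Rightarrow> 'r sect \<Rightarrow> 'r sect set set" where
  "gr_class sd C Q \<mu> \<sigma> = {fibre_class sd C Q \<sigma>' | \<sigma>'. \<sigma>' \<in> E_end_near sd C Q \<and>
     growth_F sd C Q \<mu> \<sigma>' \<and> (\<exists>\<nu><\<mu>. fibre_class sd C Q (\<lambda>x. \<sigma> x - \<sigma>' x) \<in> filt sd C Q \<nu>)}"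

definition gr_filt :: "side \<Rightarrow> choice \<Rightarrow> complex \<Rightarrow> rat \<Rightarrow> real \<Rightarrow> 'r sect set set set" where
  "gr_filt sd C Q \<mu> b = {gr_class sd C Q \<mu> \<sigma> | \<sigma>. \<sigma> \<in> E_end_near sd C Q \<and>
     growth_F sd C Q \<mu> \<sigma> \<and> growth_Gr sd C Q \<mu> b \<sigma>}"

definition associated_object :: "choice \<Rightarrow> 'r filtered_object" where
  "associated_object C =
     \<lparr> fo_divisor = divisor,
       fo_sections = E_tilde C,
       fo_points = par_points C,
       fo_lattices = par_lattices C,
       fo_filt = (\<lambda>sd Q \<mu>. filt sd C Q \<mu>),
       fo_gr_filt = (\<lambda>sd Q \<mu> b. gr_filt sd C Q \<mu> b) \<rparr>"

end

end

theory Submission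
  imports Defs "HOL-Complex_Analysis.Cauchy_Integral_Formula"
begin

text \<open>
The object attached to a choice is built from the projection \<open>proj\<close> to the elliptic curve, which is
  the same for all choices, and from the coordinates \<open>(y, t)\<close>, which enter in three ways only.

  The first is the function \<open>f = t - log \<bar>y\<bar> / log \<bar>q\<bar>\<close>, which orders the singularities over a point and
  measures growth towards the two ends. It is \<open>\<real>\<close>-linear on \<open>\<complex> \<times> \<real>\<close> and invariant under \<open>\<Gamma>\<close>, hence a
  multiple of \<open>y\<^sub>0\<close>. On the fibres of \<open>proj\<close> the unnormalised coordinate \<open>tt_coord\<close> has slope \<open>1\<close> in \<open>\<tau>\<close>, so that
  \<open>t\<^sup>\<lambda> f\<close> equals \<open>(1 + \<bar>\<lambda>\<bar>\<^sup>2) / (1 - \<bar>\<lambda>\<bar>\<^sup>2) y\<^sub>0\<close> for every choice (lemma \<open>t_lam_f_fun\<close>).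
  Thus two choices give functions \<open>f\<close> that differ by a constant factor \<open>r\<close>, and the sign of \<open>r\<close> decides
  whether the two ends are exchanged.

  The second is the constant \<open>\<bar>log \<bar>q\<bar>\<bar>\<close> in the growth conditions. Since \<open>s\<^sub>1\<close> is real,
  \<open>\<bar>\<mu>\<^sub>1 + \<lambda>\<^sup>2 cnj \<mu>\<^sub>1\<bar> = (1 + \<bar>\<lambda>\<bar>\<^sup>2) \<bar>Re (g\<^sub>1 \<mu>\<^sub>1)\<bar>\<close>, and with this \<open>\<bar>log \<bar>q\<bar>\<bar>\<close> is the square of \<open>t\<^sup>\<lambda>\<close> times a
  factor that depends only on \<open>\<lambda>\<close> and on the area of the lattice (lemma \<open>log_abs_q_eq\<close>). So
  \<open>\<bar>log \<bar>q\<bar>\<bar> f\<^sup>2\<close> is the same for all choices, which is why the slopes need no rescaling. The function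
  \<open>\<bar>log \<bar>q\<bar>\<bar> \<bar>f\<bar>\<close> is proportional to \<open>\<bar>t\<^sup>\<lambda>\<bar>\<close>, and the rescaling moves this factor into the index of
  the second filtration.

  The third is the slice \<open>t = const\<close> used to say what a meromorphic section at a point of the divisor
  is. A section of the sheaf is determined along a segment of a fibre of \<open>proj\<close> by its value at one point,
  because \<open>\<nabla>\<^sub>\<tau> - \<i> \<phi>\<close> is a linear ordinary differential operator on the fibre. An identity between two
  sections that holds on the slice therefore holds near the point in the three-manifold, where the slice
  is no longer visible; and near \<open>x\<^sub>0\<close> the function \<open>y - y(x\<^sub>0)\<close> is an invertible holomorphic function of \<open>proj\<close> times
  \<open>proj - proj(x\<^sub>0)\<close>. Hence the module on the elliptic curve is the same for all choices
  (lemma \<open>E_tilde_independent\<close>).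

  Given these three facts, every part of the structure for one choice is rewritten into the
  corresponding part for the other; for \<open>r < 0\<close> the two sides are exchanged and the lists are reversed,
  exactly as in the definition of the rescaling (lemma \<open>rescale_associated_object_eq\<close>).
\<close>

section \<open>The coordinates attached to an admissible choice\<close>

lemma one_minus_g1_nonzero:
  assumes "admissible \<Gamma> lam C" and "cmod lam \<noteq> 1"
  shows "1 - g1 C * lam \<noteq> 0"
proof
  assume "1 - g1 C * lam = 0"
  then have "g1 C * lam = 1" by simp
  then have "cmod (g1 C * lam) = 1" by simp
  with assms show False by (simp add: admissible_def norm_mult)
qed

lemma cmod_one_minus_g1:
  assumes "admissible \<Gamma> lam C"
  shows "(cmod (1 - g1 C * lam))\<^sup>2 = 1 + (cmod lam)\<^sup>2 - 2 * Re (g1 C * lam)"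
proof -
  have "(cmod (1 - w))\<^sup>2 = 1 + (cmod w)\<^sup>2 - 2 * Re w" for w
    unfolding cmod_power2 by (simp add: power2_eq_square algebra_simps)
  then show ?thesis using assms by (simp add: admissible_def norm_mult)
qed

text \<open>
  The defining equation of \<open>g\<^sub>1\<close> turns \<open>\<lambda> g\<^sub>1 (\<mu>\<^sub>1 + \<lambda> s\<^sub>1)\<close> into \<open>\<lambda> s\<^sub>1 - \<lambda>\<^sup>2 cnj \<mu>\<^sub>1\<close>. This is why the
  coordinate \<open>y\<close>, whose definition involves \<open>s\<^sub>1\<close> and \<open>g\<^sub>1\<close>, only sees the period of the elliptic
  curve.
\<close>

lemma period_factorisation:
  assumes "admissible \<Gamma> lam C"
  shows "(mu1 C + lam * of_real (s1 C)) * (1 - g1 C * lam) = mu1 C + lam\<^sup>2 * cnj (mu1 C)"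
proof -
  have e: "g1 C * (mu1 C + lam * of_real (s1 C)) = - lam * cnj (mu1 C) + of_real (s1 C)"
    using assms by (simp add: admissible_def)
  have "(mu1 C + lam * of_real (s1 C)) * (1 - g1 C * lam) =
      mu1 C + lam * of_real (s1 C) - lam * (g1 C * (mu1 C + lam * of_real (s1 C)))"
    by (simp add: algebra_simps)
  also have "\<dots> = mu1 C + lam\<^sup>2 * cnj (mu1 C)"
    unfolding e by (simp add: algebra_simps power2_eq_square)
  finally show ?thesis .
qed

lemma first_period_nonzero:
  assumes "admissible \<Gamma> lam C" and "cmod lam \<noteq> 1"
  shows "mu1 C + lam\<^sup>2 * cnj (mu1 C) \<noteq> 0"
  using period_factorisation[OF assms(1)] one_minus_g1_nonzero[OF assms] assms(1)
  by (auto simp: admissible_def)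

text \<open>
  Solving the defining equation gives \<open>s\<^sub>1 (1 - g\<^sub>1 \<lambda>) = g\<^sub>1 \<mu>\<^sub>1 + \<lambda> cnj \<mu>\<^sub>1\<close>; the identity says that
  \<open>(g\<^sub>1 \<mu>\<^sub>1 + \<lambda> cnj \<mu>\<^sub>1) cnj (1 - g\<^sub>1 \<lambda>) = s\<^sub>1 \<bar>1 - g\<^sub>1 \<lambda>\<bar>\<^sup>2\<close> has no imaginary part.
\<close>

lemma s1_real_condition:
  assumes "admissible \<Gamma> lam C"
  shows "(1 + (cmod lam)\<^sup>2) * Im (g1 C * mu1 C) = 2 * Im (cnj lam * mu1 C)"
proof -
  define g where "g = g1 C"
  define \<mu> where "\<mu> = mu1 C"
  have gg: "g * cnj g = 1"
    using assms by (simp add: admissible_def g_def complex_norm_square[symmetric])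
  have ll: "lam * cnj lam = of_real ((cmod lam)\<^sup>2)"
    by (simp add: complex_norm_square[symmetric])
  have "of_real (s1 C) * (1 - g * lam) = g * \<mu> + lam * cnj \<mu>"
    using assms by (simp add: admissible_def g_def \<mu>_def algebra_simps)
  then have "of_real (s1 C) * ((1 - g * lam) * cnj (1 - g * lam)) = (g * \<mu> + lam * cnj \<mu>) * cnj (1 - g * lam)"
    by (simp add: mult.assoc[symmetric])
  also have "\<dots> = g * \<mu> + lam * cnj \<mu> - (g * cnj g) * (cnj lam * \<mu>) - (lam * cnj lam) * (cnj g * cnj \<mu>)"
    by (simp add: algebra_simps)
  also have "\<dots> = g * \<mu> + lam * cnj \<mu> - cnj lam * \<mu> - of_real ((cmod lam)\<^sup>2) * cnj (g * \<mu>)"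
    unfolding gg ll by simp
  finally have "Im (of_real (s1 C) * ((1 - g * lam) * cnj (1 - g * lam))) =
      Im (g * \<mu> + lam * cnj \<mu> - cnj lam * \<mu> - of_real ((cmod lam)\<^sup>2) * cnj (g * \<mu>))"
    by simp
  then have "0 = (1 + (cmod lam)\<^sup>2) * Im (g * \<mu>) - 2 * Im (cnj lam * \<mu>)"
    by (simp add: algebra_simps complex_norm_square[symmetric])
  then show ?thesis by (simp add: g_def \<mu>_def)
qed

text \<open>
  The left hand side expands to \<open>(1 + \<bar>\<lambda>\<bar>\<^sup>2)\<^sup>2 \<bar>\<mu>\<^sub>1\<bar>\<^sup>2 - 4 (Im (cnj \<lambda> \<mu>\<^sub>1))\<^sup>2\<close>; by the reality of \<open>s\<^sub>1\<close>
  the subtracted term is \<open>(1 + \<bar>\<lambda>\<bar>\<^sup>2)\<^sup>2 (Im (g\<^sub>1 \<mu>\<^sub>1))\<^sup>2\<close>, and \<open>\<bar>\<mu>\<^sub>1\<bar> = \<bar>g\<^sub>1 \<mu>\<^sub>1\<bar>\<close>.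
\<close>

lemma cmod_first_period:
  assumes "admissible \<Gamma> lam C"
  shows "(cmod (mu1 C + lam\<^sup>2 * cnj (mu1 C)))\<^sup>2 = (1 + (cmod lam)\<^sup>2)\<^sup>2 * (Re (g1 C * mu1 C))\<^sup>2"
proof -
  define n where "n = 1 + (cmod lam)\<^sup>2"
  have Y: "n * Im (g1 C * mu1 C) = 2 * Im (cnj lam * mu1 C)"
    using s1_real_condition[OF assms] by (simp add: n_def)
  have N: "(cmod (mu1 C))\<^sup>2 = (Re (g1 C * mu1 C))\<^sup>2 + (Im (g1 C * mu1 C))\<^sup>2"
    using assms by (simp only: cmod_power2[symmetric] norm_mult admissible_def) simp
  have "(cmod (mu1 C + lam\<^sup>2 * cnj (mu1 C)))\<^sup>2 =
      n\<^sup>2 * (cmod (mu1 C))\<^sup>2 - (2 * Im (cnj lam * mu1 C))\<^sup>2"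
    unfolding n_def cmod_power2 by (simp add: Re_power2 Im_power2) algebra
  also have "\<dots> = n\<^sup>2 * (Re (g1 C * mu1 C))\<^sup>2"
    unfolding N Y[symmetric] by (simp add: algebra_simps power2_eq_square)
  finally show ?thesis by (simp add: n_def)
qed

lemma Re_g1_mu1_nonzero:
  assumes "admissible \<Gamma> lam C" and "cmod lam \<noteq> 1"
  shows "Re (g1 C * mu1 C) \<noteq> 0"
  using cmod_first_period[OF assms(1)] first_period_nonzero[OF assms] by auto

lemma area_pos:
  assumes "oriented_basis \<Gamma> \<mu>1 \<mu>2"
  shows "Im (cnj \<mu>1 * \<mu>2) > 0"
proof -
  have p: "Im (\<mu>2 / \<mu>1) > 0" using assms by (simp add: oriented_basis_def)
  then have "\<mu>1 \<noteq> 0" by auto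
  then have "cnj \<mu>1 * \<mu>2 = of_real ((cmod \<mu>1)\<^sup>2) * (\<mu>2 / \<mu>1)"
    by (simp add: complex_norm_square field_simps del: of_real_power)
  then have "Im (cnj \<mu>1 * \<mu>2) = (cmod \<mu>1)\<^sup>2 * Im (\<mu>2 / \<mu>1)"
    by (metis Im_complex_of_real Re_complex_of_real mult_zero_left add_0_right times_complex.sel(2))
  then show ?thesis using p \<open>\<mu>1 \<noteq> 0\<close> by simp
qed

text \<open>
  The change of basis is an integral matrix whose determinant is positive, hence at least \<open>1\<close>.
\<close>

lemma oriented_basis_area_le:
  assumes "oriented_basis \<Gamma> \<mu>1 \<mu>2" and "oriented_basis \<Gamma> \<nu>1 \<nu>2"
  shows "Im (cnj \<mu>1 * \<mu>2) \<le> Im (cnj \<nu>1 * \<nu>2)"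
proof -
  have \<Gamma>: "\<Gamma> = {of_int m * \<mu>1 + of_int n * \<mu>2 | m n. True}" "\<Gamma> = {of_int m * \<nu>1 + of_int n * \<nu>2 | m n. True}"
    using assms by (simp_all add: oriented_basis_def)
  have "\<nu>1 \<in> \<Gamma>" "\<nu>2 \<in> \<Gamma>"
    unfolding \<Gamma>(2) by (force intro: exI[of _ 1] exI[of _ 0])+
  then obtain a b c d :: int where ab: "\<nu>1 = of_int a * \<mu>1 + of_int b * \<mu>2"
    and cd: "\<nu>2 = of_int c * \<mu>1 + of_int d * \<mu>2"
    unfolding \<Gamma>(1) by auto
  have e: "Im (cnj \<nu>1 * \<nu>2) = of_int (a * d - b * c) * Im (cnj \<mu>1 * \<mu>2)"
    unfolding ab cd by (simp add: algebra_simps)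
  then have "of_int (a * d - b * c) * Im (cnj \<mu>1 * \<mu>2) > 0"
    using area_pos[OF assms(2)] by simp
  then have "of_int (a * d - b * c) > (0::real)"
    using area_pos[OF assms(1)] zero_less_mult_pos2 by blast
  then have "(1::real) \<le> of_int (a * d - b * c)"
    by (simp only: of_int_0_less_iff of_int_1_le_iff int_one_le_iff_zero_less)
  then show ?thesis
    unfolding e using area_pos[OF assms(1)] by simp
qed

lemma area_independent:
  assumes "oriented_basis \<Gamma> \<mu>1 \<mu>2" and "oriented_basis \<Gamma> \<nu>1 \<nu>2"
  shows "Im (cnj \<mu>1 * \<mu>2) = Im (cnj \<nu>1 * \<nu>2)"
  using oriented_basis_area_le assms by (meson order_antisym)

lemma Im_period_product:
  "Im ((z + lam\<^sup>2 * cnj z) * cnj (w + lam\<^sup>2 * cnj w)) = (1 - (cmod lam)\<^sup>2) * (1 + (cmod lam)\<^sup>2) * Im (cnj w * z)"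
  unfolding cmod_power2 by (simp add: Re_power2 Im_power2) algebra

lemma t_lam_nonzero:
  assumes "admissible \<Gamma> lam C" and "cmod lam \<noteq> 1"
  shows "t_lam C \<noteq> 0"
  using Re_g1_mu1_nonzero[OF assms] area_pos[of \<Gamma> "mu1 C" "mu2 C"] assms(1)
  by (auto simp: t_lam_def admissible_def)

lemma y_coord_eq:
  assumes "admissible \<Gamma> lam C"
  shows "y_coord lam C x = exp (2 * pi * \<i> / (mu1 C + lam\<^sup>2 * cnj (mu1 C)) * proj lam x)"
proof -
  have "1 + (cmod lam)\<^sup>2 \<noteq> 0" by (smt (verit) zero_le_power2)
  then have "of_real (1 + (cmod lam)\<^sup>2) * alpha_coord lam x = proj lam x"
    by (simp add: alpha_coord_def proj_def del: of_real_add)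
  then have "u_coord lam C x = proj lam x / (1 - g1 C * lam)"
    by (simp add: u_coord_def)
  then show ?thesis
    by (simp add: y_coord_def flip: period_factorisation[OF assms])
qed

lemma ln_cmod_exp_quotient:
  assumes "a \<noteq> 0"
  shows "ln (cmod (exp (2 * pi * \<i> / a * p))) = - 2 * pi * Im (p * cnj a) / (cmod a)\<^sup>2"
proof -
  have "p / a = p * cnj a / of_real ((cmod a)\<^sup>2)"
    using assms by (simp add: complex_norm_square del: of_real_power)
  then have "Im (p / a) = Im (p * cnj a) / (cmod a)\<^sup>2"
    by (metis Im_divide_of_real)
  moreover have "2 * pi * \<i> / a * p = of_real (2 * pi) * (\<i> * (p / a))"
    by simp
  then have "Re (2 * pi * \<i> / a * p) = Re (of_real (2 * pi) * (\<i> * (p / a)))"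
    by (rule arg_cong)
  then have "Re (2 * pi * \<i> / a * p) = - 2 * pi * Im (p / a)"
    by (simp only: times_complex.sel Re_complex_of_real Im_complex_of_real) simp
  ultimately show ?thesis
    by simp
qed

lemma ln_cmod_q:
  assumes "admissible \<Gamma> lam C" and "cmod lam \<noteq> 1"
  shows "ln (cmod (q_lam lam C)) = - 2 * pi * ((1 - (cmod lam)\<^sup>2) * (1 + (cmod lam)\<^sup>2) * Im (cnj (mu1 C) * mu2 C))
           / (cmod (mu1 C + lam\<^sup>2 * cnj (mu1 C)))\<^sup>2"
  using ln_cmod_exp_quotient[OF first_period_nonzero[OF assms], of "mu2 C + lam\<^sup>2 * cnj (mu2 C)"]
  by (simp only: q_lam_def times_divide_eq_left Im_period_product)

lemma cmod_square_not_1: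
  assumes "cmod lam \<noteq> 1"
  shows "1 - (cmod lam)\<^sup>2 \<noteq> 0" "1 + (cmod lam)\<^sup>2 > 0"
  using assms by (auto simp: power2_eq_1_iff add_pos_nonneg)  (smt (verit) norm_ge_zero)+

lemma tt_coord_eq:
  assumes "admissible \<Gamma> lam C" and "cmod lam \<noteq> 1"
  shows "(cmod (1 - g1 C * lam))\<^sup>2 * tt_coord lam C x =
     (1 - (cmod lam)\<^sup>2) * snd x - Im (((1 + (cmod lam)\<^sup>2) * g1 C - 2 * cnj lam) * fst x)"
proof -
  define g where "g = g1 C"
  have "1 - g * lam \<noteq> 0"
    using one_minus_g1_nonzero[OF assms] by (simp add: g_def)
  then have quot: "(cmod (1 - g * lam))\<^sup>2 * Im (w / (1 - g * lam)) = Im (w * cnj (1 - g * lam))" for w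
  proof -
    have "of_real ((cmod (1 - g * lam))\<^sup>2) * (w / (1 - g * lam)) = w * cnj (1 - g * lam)"
      using \<open>1 - g * lam \<noteq> 0\<close> by (simp add: complex_norm_square del: of_real_power complex_cnj_diff complex_cnj_mult)
    then have "Im (of_real ((cmod (1 - g * lam))\<^sup>2) * (w / (1 - g * lam))) = Im (w * cnj (1 - g * lam))"
      by simp
    then show ?thesis by (simp only: Im_complex_of_real Re_complex_of_real times_complex.sel mult_zero_left add_0_right)
  qed
  have gg: "(Re g)\<^sup>2 + (Im g)\<^sup>2 = 1"
    using assms by (simp add: admissible_def g_def flip: cmod_power2)
  show ?thesis
    unfolding tt_coord_def g_def[symmetric] quot
    unfolding cmod_power2 using gg
    by simp algebra
qed

text \<open>
  Both sides are \<open>\<real>\<close>-linear in \<open>x\<close>. Write \<open>g\<^sub>1 \<mu>\<^sub>1 = X + \<i> Y\<close> and \<open>cnj \<lambda> \<mu>\<^sub>1 = A + \<i> B\<close>. The quotient of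
  logarithms in \<open>f\<close> is \<open>Im (proj x * cnj a)\<close> over a multiple of the area, where \<open>a\<close> is the period of
  \<open>\<mu>\<^sub>1\<close>; it has to cancel the part of \<open>tt_coord\<close> that depends on \<open>z\<close>. That part is a multiple of
  \<open>Im (cnj \<mu>\<^sub>1 * z)\<close>, because \<open>tt_coord\<close> is invariant under translation by \<open>\<mu>\<^sub>1\<close>; this is the relation
  \<open>n Y = 2 B\<close>. Denominators are removed by \<open>D = \<bar>1 - g\<^sub>1 \<lambda>\<bar>\<^sup>2\<close> and \<open>N = \<bar>\<mu>\<^sub>1\<bar>\<^sup>2\<close>.
\<close>

lemma t_lam_f_fun:
  assumes "admissible \<Gamma> lam C" and "cmod lam \<noteq> 1"
  shows "t_lam C * f_fun lam C x = (1 + (cmod lam)\<^sup>2) / (1 - (cmod lam)\<^sup>2) * snd x"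
proof -
  define n m where "n = 1 + (cmod lam)\<^sup>2" and "m = 1 - (cmod lam)\<^sup>2"
  define \<mu> where "\<mu> = mu1 C"
  define a where "a = \<mu> + lam\<^sup>2 * cnj \<mu>"
  define D where "D = (cmod (1 - g1 C * lam))\<^sup>2"
  define X Y where "X = Re (g1 C * \<mu>)" and "Y = Im (g1 C * \<mu>)"
  define A B where "A = Re (cnj lam * \<mu>)" and "B = Im (cnj lam * \<mu>)"
  define N where "N = (cmod \<mu>)\<^sup>2"
  define V where "V = Im (cnj \<mu> * fst x)"
  define vol where "vol = Im (cnj \<mu> * mu2 C)"
  define T where "T = tt_coord lam C x"
  have nz: "X \<noteq> 0" "m \<noteq> 0" "n \<noteq> 0" "vol \<noteq> 0" "D \<noteq> 0" "N \<noteq> 0" "(cmod a)\<^sup>2 \<noteq> 0"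
    using Re_g1_mu1_nonzero[OF assms] cmod_square_not_1[OF assms(2)] area_pos[of \<Gamma> "mu1 C" "mu2 C"]
      one_minus_g1_nonzero[OF assms] first_period_nonzero[OF assms] assms(1)
    by (auto simp: X_def m_def n_def vol_def D_def N_def a_def \<mu>_def admissible_def)
  have gl: "cmod (g1 C) = 1" using assms(1) by (simp add: admissible_def)
  have Y: "n * Y = 2 * B"
    using s1_real_condition[OF assms(1)] by (simp add: n_def Y_def B_def \<mu>_def)
  have N: "N = X\<^sup>2 + Y\<^sup>2"
    using gl unfolding N_def X_def Y_def by (simp only: cmod_power2[symmetric] norm_mult) simp
  have L: "(cmod lam)\<^sup>2 * N = A\<^sup>2 + B\<^sup>2"
    unfolding N_def A_def B_def by (simp only: cmod_power2[symmetric] norm_mult power_mult_distrib complex_mod_cnj)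
  have ND: "N * D = X * (n * X - 2 * A)"
  proof -
    have "N * Re (g1 C * lam) = Re ((g1 C * \<mu>) * cnj (cnj lam * \<mu>))"
      unfolding N_def cmod_power2 by simp algebra
    also have "\<dots> = X * A + Y * B"
      unfolding X_def Y_def A_def B_def by (simp add: algebra_simps)
    finally have 1: "N * Re (g1 C * lam) = X * A + Y * B" .
    have "D = n - 2 * Re (g1 C * lam)"
      using cmod_one_minus_g1[OF assms(1)] by (simp add: D_def n_def)
    then have "N * D = n * N - 2 * (X * A + Y * B)"
      by (simp add: right_diff_distrib 1[symmetric])
    then show ?thesis using Y N by algebra
  qed
  have T: "N * D * T = N * m * snd x - (n * X - 2 * A) * V"
  proof -
    define w where "w = (1 + (cmod lam)\<^sup>2) * g1 C - 2 * cnj lam"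
    have "w * \<mu> = of_real n * (g1 C * \<mu>) - 2 * (cnj lam * \<mu>)"
      by (simp add: w_def n_def algebra_simps)
    \<comment> \<open>The imaginary part is \<open>n Y - 2 B = 0\<close>, by the reality of \<open>s1\<close>.\<close>
    then have "w * \<mu> = of_real (n * X - 2 * A)"
      using Y by (simp add: complex_eq_iff X_def Y_def A_def B_def)
    then have "Im (w * \<mu> * (cnj \<mu> * fst x)) = (n * X - 2 * A) * V"
      unfolding V_def by (simp only: Im_complex_of_real Re_complex_of_real times_complex.sel mult_zero_left add_0_right)
    moreover have "w * \<mu> * (cnj \<mu> * fst x) = of_real N * (w * fst x)"
      unfolding N_def complex_norm_square by (simp only: mult_ac)
    ultimately have "N * Im (w * fst x) = (n * X - 2 * A) * V"
      by (simp only: Im_complex_of_real Re_complex_of_real times_complex.sel mult_zero_left add_0_right)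
    moreover have "D * T = m * snd x - Im (w * fst x)"
      using tt_coord_eq[OF assms] by (simp only: D_def T_def m_def w_def)
    ultimately show ?thesis by algebra
  qed
  have P: "Im (proj lam x * cnj a) = m * n * V - 2 * n * A * snd x"
  proof -
    have 1: "Im (proj lam x * cnj a) = Im ((fst x + lam\<^sup>2 * cnj (fst x)) * cnj a) - 2 * snd x * Re (lam * cnj a)"
      unfolding proj_def by (simp add: algebra_simps)
    have 2: "Im ((fst x + lam\<^sup>2 * cnj (fst x)) * cnj a) = m * n * V"
      unfolding a_def Im_period_product m_def n_def V_def by (rule refl)
    have 3: "Re (lam * cnj a) = n * A"
      unfolding a_def n_def A_def cmod_power2 by (simp add: Re_power2 Im_power2) algebra
    show ?thesis
      unfolding 1 2 3 by simp
  qed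
  \<comment> \<open>The terms in \<open>V\<close>, that is those depending on \<open>fst x\<close>, cancel.\<close>
  have key: "T * X * m * n + Im (proj lam x * cnj a) = n\<^sup>2 * X * snd x"
  proof -
    have mn: "m\<^sup>2 * N = n\<^sup>2 * X\<^sup>2 - 4 * A\<^sup>2"
    proof -
      have "m\<^sup>2 * N = n\<^sup>2 * N - 4 * ((cmod lam)\<^sup>2 * N)"
        unfolding m_def n_def by algebra
      then show ?thesis unfolding L using N Y by algebra
    qed
    have "N * D * (T * X * m * n + (m * n * V - 2 * n * A * snd x)) = N * D * (n\<^sup>2 * X * snd x)"
      using T ND mn by algebra
    then show ?thesis unfolding P using nz by simp
  qed
  have f: "f_fun lam C x = T / t_lam C - Im (proj lam x * cnj a) / (m * n * vol)"
  proof -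
    have y: "ln (cmod (y_coord lam C x)) = - 2 * pi * Im (proj lam x * cnj a) / (cmod a)\<^sup>2"
      unfolding y_coord_eq[OF assms(1)] a_def \<mu>_def by (rule ln_cmod_exp_quotient[OF first_period_nonzero[OF assms]])
    have q: "ln (cmod (q_lam lam C)) = - 2 * pi * (m * n * vol) / (cmod a)\<^sup>2"
      unfolding ln_cmod_q[OF assms] m_def n_def vol_def a_def \<mu>_def by (rule refl)
    have "(- 2 * pi * r / (cmod a)\<^sup>2) / (- 2 * pi * r' / (cmod a)\<^sup>2) = r / r'" for r r'
      using nz(7) by simp
    then have "ln (cmod (y_coord lam C x)) / ln (cmod (q_lam lam C)) = Im (proj lam x * cnj a) / (m * n * vol)"
      unfolding y q .
    then show ?thesis by (simp add: f_fun_def t_coord_def T_def)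
  qed
  have "t_lam C = - vol / X"
    by (simp add: t_lam_def vol_def X_def \<mu>_def)
  then have "t_lam C * (T / t_lam C - I / (m * n * vol)) = T + I / (X * m * n)" for I
    using nz by (simp add: right_diff_distrib)
  then have "t_lam C * f_fun lam C x = T + Im (proj lam x * cnj a) / (X * m * n)"
    unfolding f .
  also have "\<dots> = (T * X * m * n + Im (proj lam x * cnj a)) / (X * m * n)"
    using nz by (simp add: field_simps)
  also have "\<dots> = n / m * snd x"
    unfolding key using nz by (simp add: field_simps power2_eq_square)
  finally show ?thesis by (simp add: n_def m_def)
qed

text \<open>
  All dependence on the choice is in \<open>t_lam C\<close>, since the area is that of the lattice.
\<close>

lemma log_abs_q_eq:
  assumes "admissible \<Gamma> lam C" and "cmod lam \<noteq> 1"
  shows "log_abs_q lam C = 2 * pi * \<bar>1 - (cmod lam)\<^sup>2\<bar> / ((1 + (cmod lam)\<^sup>2) * Im (cnj (mu1 C) * mu2 C)) * (t_lam C)\<^sup>2"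
proof -
  define n m X vol where "n = 1 + (cmod lam)\<^sup>2" and "m = 1 - (cmod lam)\<^sup>2"
    and "X = Re (g1 C * mu1 C)" and "vol = Im (cnj (mu1 C) * mu2 C)"
  have nz: "vol > 0" "n > 0" "X \<noteq> 0"
    using area_pos[of \<Gamma> "mu1 C" "mu2 C"] assms cmod_square_not_1[OF assms(2)] Re_g1_mu1_nonzero[OF assms]
    by (auto simp: admissible_def n_def X_def vol_def)
  have "log_abs_q lam C = \<bar>- 2 * pi * (m * n * vol) / (n\<^sup>2 * X\<^sup>2)\<bar>"
    unfolding log_abs_q_def ln_cmod_q[OF assms] cmod_first_period[OF assms(1)] n_def m_def X_def vol_def by (rule refl)
  also have "\<dots> = 2 * pi * (\<bar>m\<bar> * n * vol) / (n\<^sup>2 * X\<^sup>2)"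
    using nz by (simp add: abs_mult)
  also have "\<dots> = 2 * pi * \<bar>m\<bar> / (n * vol) * (- vol / X)\<^sup>2"
    using nz by (simp add: field_simps power2_eq_square)
  finally show ?thesis by (simp add: t_lam_def n_def m_def X_def vol_def)
qed

section \<open>Smooth maps\<close>

lemma Ck_on_subset: "Ck_on k S f \<Longrightarrow> T \<subseteq> S \<Longrightarrow> Ck_on k T f"
  by (induction k arbitrary: f) (auto intro: continuous_on_subset)

text \<open>
  Needed because \<open>Ck_on\<close> differentiates functions that are defined everywhere but controlled only on
  an open set.
\<close>

lemma frechet_derivative_cong_open:
  assumes "open S" "x \<in> S" "\<And>y. y \<in> S \<Longrightarrow> f y = g y"
  shows "frechet_derivative f (at x) = frechet_derivative g (at x)"
proof -
  have "(f has_derivative d) (at x) \<longleftrightarrow> (g has_derivative d) (at x)" for d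
    using has_derivative_transform_within_open[OF _ assms(1,2), of f d UNIV g]
      has_derivative_transform_within_open[OF _ assms(1,2), of g d UNIV f] assms(3) by auto
  then show ?thesis unfolding frechet_derivative_def by simp
qed

lemma Ck_on_cong:
  assumes "open S" "\<And>x. x \<in> S \<Longrightarrow> f x = g x"
  shows "Ck_on k S f \<Longrightarrow> Ck_on k S g"
  using assms(2)
proof (induction k arbitrary: f g)
  case 0
  then show ?case using continuous_on_cong[OF refl, of S f g] by simp
next
  case (Suc k)
  have d: "g differentiable (at x)" if "x \<in> S" for x
  proof -
    have "f differentiable (at x)" using Suc.prems that by simp
    then show ?thesis
      unfolding differentiable_def
      using has_derivative_transform_within_open[OF _ assms(1) that, of f _ UNIV g] Suc.prems(2) by blast
  qed
  have "Ck_on k S (\<lambda>x. frechet_derivative g (at x) v)" for v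
  proof (rule Suc.IH)
    show "Ck_on k S (\<lambda>x. frechet_derivative f (at x) v)" using Suc.prems by simp
    show "frechet_derivative f (at x) v = frechet_derivative g (at x) v" if "x \<in> S" for x
      using frechet_derivative_cong_open[OF assms(1) that, of f g] Suc.prems(2) by simp
  qed
  with d show ?case by simp
qed

lemma Ck_on_Suc_imp: "Ck_on (Suc k) S f \<Longrightarrow> Ck_on k S f"
proof (induction k arbitrary: f)
  case 0
  then show ?case
    by (auto intro!: continuous_at_imp_continuous_on differentiable_imp_continuous_within)
next
  case (Suc k)
  from Suc.prems have "Ck_on k S (\<lambda>x. frechet_derivative f (at x) v)" for v
    by (intro Suc.IH) simp
  with Suc.prems show ?case by simp
qed

lemma Ck_on_add:
  assumes "open S"
  shows "Ck_on k S f \<Longrightarrow> Ck_on k S g \<Longrightarrow> Ck_on k S (\<lambda>x. f x + g x)"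
proof (induction k arbitrary: f g)
  case 0
  then show ?case by (simp add: continuous_on_add)
next
  case (Suc k)
  have "Ck_on k S (\<lambda>x. frechet_derivative (\<lambda>x. f x + g x) (at x) v)" for v
  proof (rule Ck_on_cong[OF assms])
    show "Ck_on k S (\<lambda>x. frechet_derivative f (at x) v + frechet_derivative g (at x) v)"
      using Suc by (intro Suc.IH) simp_all
    show "frechet_derivative f (at x) v + frechet_derivative g (at x) v =
      frechet_derivative (\<lambda>x. f x + g x) (at x) v" if "x \<in> S" for x
    proof -
      have "((\<lambda>x. f x + g x) has_derivative
          (\<lambda>h. frechet_derivative f (at x) h + frechet_derivative g (at x) h)) (at x)"
        using Suc.prems that by (intro has_derivative_add) (auto simp: frechet_derivative_works[symmetric])
      then show ?thesis by (simp add: frechet_derivative_at[symmetric])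
    qed
  qed
  with Suc.prems show ?case by simp
qed

text \<open>
  The derivative of a product is again a sum of products, whose factors are of class \<open>C\<^sup>k\<close>; for the
  undifferentiated factors this is \<open>Ck_on_Suc_imp\<close>.
\<close>

lemma Ck_on_bounded_bilinear:
  assumes b: "bounded_bilinear b" and "open S"
  shows "Ck_on k S f \<Longrightarrow> Ck_on k S g \<Longrightarrow> Ck_on k S (\<lambda>x. b (f x) (g x))"
proof (induction k arbitrary: f g)
  case 0
  then show ?case by (simp add: bounded_bilinear.continuous_on[OF b])
next
  case (Suc k)
  have der: "((\<lambda>x. b (f x) (g x)) has_derivative
      (\<lambda>h. b (f x) (frechet_derivative g (at x) h) + b (frechet_derivative f (at x) h) (g x))) (at x)" if "x \<in> S" for x
    using Suc.prems that by (intro bounded_bilinear.FDERIV[OF b]) (auto simp: frechet_derivative_works[symmetric])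
  have "Ck_on k S (\<lambda>x. frechet_derivative (\<lambda>x. b (f x) (g x)) (at x) v)" for v
  proof (rule Ck_on_cong[OF assms(2)])
    show "Ck_on k S (\<lambda>x. b (f x) (frechet_derivative g (at x) v) + b (frechet_derivative f (at x) v) (g x))"
      using Suc.prems by (intro Ck_on_add[OF assms(2)] Suc.IH) (auto simp del: Ck_on.simps intro: Ck_on_Suc_imp simp: Ck_on.simps(2)[of k])
    show "b (f x) (frechet_derivative g (at x) v) + b (frechet_derivative f (at x) v) (g x) =
      frechet_derivative (\<lambda>x. b (f x) (g x)) (at x) v" if "x \<in> S" for x
      by (simp add: frechet_derivative_at[OF der[OF that], symmetric])
  qed
  moreover have "(\<lambda>x. b (f x) (g x)) differentiable (at x)" if "x \<in> S" for x
    using der[OF that] by (rule differentiableI)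
  ultimately show ?case by simp
qed

lemma smooth_on_subset: "smooth_on S f \<Longrightarrow> T \<subseteq> S \<Longrightarrow> smooth_on T f"
  unfolding smooth_on_def using Ck_on_subset by blast

lemma smooth_on_add:
  "open S \<Longrightarrow> smooth_on S f \<Longrightarrow> smooth_on S g \<Longrightarrow> smooth_on S (\<lambda>x. f x + g x)"
  unfolding smooth_on_def using Ck_on_add by blast

lemma smooth_on_imp_continuous_on: "smooth_on S f \<Longrightarrow> continuous_on S f"
  unfolding smooth_on_def using Ck_on.simps(1) by blast

lemma smooth_on_imp_differentiable: "smooth_on S f \<Longrightarrow> x \<in> S \<Longrightarrow> f differentiable (at x)"
  unfolding smooth_on_def using Ck_on.simps(2) by blast

lemma norm_vector_scalar_mult: "norm ((c::complex) *s (v::complex^'n)) = norm c * norm v"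
  by (simp add: norm_vec_def norm_mult L2_set_right_distrib)

lemma bounded_bilinear_vector_scalar_mult:
  "bounded_bilinear (\<lambda>(c::complex) (v::complex^'n). c *s v)"
proof
  have "norm (c *s v) \<le> norm c * norm v * 1" for c :: complex and v :: "complex^'n"
    by (simp add: norm_vector_scalar_mult)
  then show "\<exists>K. \<forall>(a::complex) b :: complex^'n. norm (a *s b) \<le> norm a * norm b * K"
    by blast
qed (simp_all add: vec_eq_iff algebra_simps)

lemma smooth_on_vector_scalar_mult:
  fixes f :: "'a::real_normed_vector \<Rightarrow> complex" and g :: "'a \<Rightarrow> complex^'n"
  assumes "open S" "smooth_on S f" "smooth_on S g"
  shows "smooth_on S (\<lambda>x. f x *s g x)"
  using assms Ck_on_bounded_bilinear[OF bounded_bilinear_vector_scalar_mult]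
  unfolding smooth_on_def by blast

lemma smooth_on_bounded_linear:
  assumes l: "bounded_linear l" and S: "open S" and f: "smooth_on S f"
  shows "smooth_on S (\<lambda>x. l (f x))"
proof -
  have "Ck_on k S f \<Longrightarrow> Ck_on k S (\<lambda>x. l (f x))" for k
  proof (induction k arbitrary: f)
    case 0
    then show ?case by (simp add: bounded_linear.continuous_on[OF l])
  next
    case (Suc k)
    have der: "((\<lambda>x. l (f x)) has_derivative (\<lambda>h. l (frechet_derivative f (at x) h))) (at x)" if "x \<in> S" for x
      using Suc.prems that by (intro bounded_linear.has_derivative[OF l]) (auto simp: frechet_derivative_works[symmetric])
    have "Ck_on k S (\<lambda>x. frechet_derivative (\<lambda>x. l (f x)) (at x) v)" for v
    proof (rule Ck_on_cong[OF S])
      show "Ck_on k S (\<lambda>x. l (frechet_derivative f (at x) v))"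
        using Suc.prems by (intro Suc.IH) simp
      show "l (frechet_derivative f (at x) v) = frechet_derivative (\<lambda>x. l (f x)) (at x) v" if "x \<in> S" for x
        by (simp add: frechet_derivative_at[OF der[OF that], symmetric])
    qed
    moreover have "(\<lambda>x. l (f x)) differentiable (at x)" if "x \<in> S" for x
      using der[OF that] by (rule differentiableI)
    ultimately show ?case by simp
  qed
  then show ?thesis using f by (simp add: smooth_on_def)
qed

lemma has_derivative_holomorphic_compose_linear:
  assumes "bounded_linear p" and "h holomorphic_on S" "open S" "p x \<in> S"
  shows "((\<lambda>x. h (p x)) has_derivative (\<lambda>v. deriv h (p x) * p v)) (at x)"
proof -
  have "(h has_derivative (*) (deriv h (p x))) (at (p x))"
    using holomorphic_derivI[OF assms(2-4)] by (simp add: has_field_derivative_def)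
  from has_derivative_compose[OF bounded_linear_imp_has_derivative[OF assms(1)] this]
  show ?thesis .
qed

text \<open>
  The derivative of \<open>h \<circ> p\<close> in a fixed direction \<open>v\<close> is \<open>(h' \<cdot> p v) \<circ> p\<close>, again a holomorphic function
  after \<open>p\<close>, so that the induction on the order reproduces the statement.
\<close>

lemma smooth_on_holomorphic_compose_linear:
  assumes p: "bounded_linear p" and S: "open S" and h: "h holomorphic_on S"
  shows "smooth_on (p -` S) (\<lambda>x. h (p x))"
proof -
  have open_p: "open (p -` S)"
    by (intro open_vimage S linear_continuous_on p)
  have "Ck_on k (p -` S) (\<lambda>x. h (p x))" for k
    using h
  proof (induction k arbitrary: h)
    case 0
    then show ?case
      using continuous_on_compose2[OF holomorphic_on_imp_continuous_on, of h S "p -` S" p]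
        bounded_linear.continuous_on[OF p continuous_on_id] by auto
  next
    case (Suc k)
    note der = has_derivative_holomorphic_compose_linear[OF p Suc.prems S]
    have "Ck_on k (p -` S) (\<lambda>x. frechet_derivative (\<lambda>x. h (p x)) (at x) v)" for v
    proof (rule Ck_on_cong[OF open_p])
      have "(\<lambda>w. deriv h w * p v) holomorphic_on S"
        using Suc.prems S by (intro holomorphic_intros)
      then show "Ck_on k (p -` S) (\<lambda>x. deriv h (p x) * p v)"
        by (rule Suc.IH)
      show "deriv h (p x) * p v = frechet_derivative (\<lambda>x. h (p x)) (at x) v" if "x \<in> p -` S" for x
        using that by (simp add: frechet_derivative_at[OF der, symmetric])
    qed
    moreover have "(\<lambda>x. h (p x)) differentiable (at x)" if "x \<in> p -` S" for x
      using der that by (auto intro: differentiableI)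
    ultimately show ?case by simp
  qed
  then show ?thesis by (simp add: smooth_on_def)
qed

section \<open>The projection to the elliptic curve\<close>

lemma bounded_linear_proj: "bounded_linear (proj lam)"
proof -
  have "linear (proj lam)"
    by (rule linearI) (simp_all add: proj_def algebra_simps scaleR_conv_of_real)
  then show ?thesis by (simp add: linear_conv_bounded_linear)
qed

lemma proj_shift: "proj lam (shift \<gamma> x) = proj lam x + (\<gamma> + lam\<^sup>2 * cnj \<gamma>)"
  by (simp add: proj_def shift_def algebra_simps)

text \<open>
  \<open>proj\<close> is \<open>(1 + \<bar>\<lambda>\<bar>\<^sup>2) \<alpha>\<close> and \<open>coord_field\<close> is inverse to \<open>(\<alpha>, \<tau>)\<close>. In particular \<open>proj\<close> is constant along
  \<open>\<partial>\<^sub>\<tau>\<close>, and its holomorphic functions are killed by \<open>\<partial>/\<partial>cnj \<alpha>\<close>.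
\<close>

lemma proj_coord_field: "proj lam (coord_field lam (a, t)) = of_real (1 + (cmod lam)\<^sup>2) * a"
proof -
  define n where "n = complex_of_real (1 + (cmod lam)\<^sup>2)"
  have n: "n = 1 + lam * cnj lam" unfolding n_def by (simp add: complex_norm_square del: of_real_power)
  have n0: "n \<noteq> 0" unfolding n_def by (smt (verit) of_real_eq_0_iff zero_le_power2)
  have m: "complex_of_real (1 - (cmod lam)\<^sup>2) = 1 - lam * cnj lam"
    by (simp add: complex_norm_square del: of_real_power)
  have r: "complex_of_real (2 * Re (\<i> * cnj lam * a)) = \<i> * cnj lam * a - \<i> * lam * cnj a"
    unfolding complex_add_cnj[symmetric] by simp
  have s: "complex_of_real ((2 * Re (\<i> * cnj lam * a) + (1 - (cmod lam)\<^sup>2) * t) / (1 + (cmod lam)\<^sup>2)) =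
     (\<i> * cnj lam * a - \<i> * lam * cnj a + (1 - lam * cnj lam) * of_real t) / n"
    unfolding of_real_divide of_real_add of_real_mult[of _ t] r m n_def by (rule refl)
  have "n * proj lam (coord_field lam (a, t)) = n * n * a"
    unfolding coord_field_eq proj_def fst_conv snd_conv s n_def[symmetric]
    using n0 by (simp add: field_simps) (simp add: n field_simps power2_eq_square)
  then show ?thesis using n0 by (simp add: n_def)
qed

lemma coord_field_tau_nonzero: "coord_field lam (0, 1) \<noteq> 0"
proof (cases "lam = 0")
  case False
  have "1 + (cmod lam)\<^sup>2 \<noteq> 0" by (smt (verit) zero_le_power2)
  with False show ?thesis
    by (auto simp: coord_field_eq prod_eq_iff complex_eq_iff)
qed (simp add: coord_field_eq prod_eq_iff)

lemma smooth_sect_subset: "smooth_sect M V s \<Longrightarrow> W \<subseteq> V \<Longrightarrow> smooth_sect M W s"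
  unfolding smooth_sect_def
  by (rule ballI, drule (1) bspec) (auto simp: split_beta elim: smooth_on_subset)

lemma smooth_sectD:
  "smooth_sect M V s \<Longrightarrow> (U, e) \<in> frames M \<Longrightarrow> smooth_on (V \<inter> U) (\<lambda>x. matrix_inv (e x) *v s x)"
  unfolding smooth_sect_def by (drule (1) bspec) simp

lemma minihol_subset: "minihol M lam V s \<Longrightarrow> W \<subseteq> V \<Longrightarrow> minihol M lam W s"
  unfolding minihol_def by (meson smooth_sect_subset subsetD)

text \<open>
  The quotient of \<open>y - y(x\<^sub>0)\<close> by \<open>proj - proj(x\<^sub>0)\<close> has a removable singularity, where its value is the
  derivative of an exponential and hence nonzero. So powers of one may be exchanged for powers of the
  other as denominators.
\<close>

lemma y_coord_difference:
  assumes "admissible \<Gamma> lam C" and "cmod lam \<noteq> 1"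
  obtains h S where "open S" "proj lam x0 \<in> S" "h holomorphic_on S" "\<And>p. p \<in> S \<Longrightarrow> h p \<noteq> 0"
    "\<And>x. y_coord lam C x - y_coord lam C x0 = h (proj lam x) * (proj lam x - proj lam x0)"
proof -
  define k where "k = 2 * pi * \<i> / (mu1 C + lam\<^sup>2 * cnj (mu1 C))"
  define f where "f = (\<lambda>p. exp (k * p))"
  define p0 where "p0 = proj lam x0"
  define h where "h = (\<lambda>p. if p = p0 then deriv f p0 else (f p - f p0) / (p - p0))"
  have k: "k \<noteq> 0" using first_period_nonzero[OF assms] by (simp add: k_def)
  have "f holomorphic_on UNIV" unfolding f_def by (intro holomorphic_intros)
  then have h: "h holomorphic_on UNIV" unfolding h_def by (rule pole_lemma_open) simp
  have "(f has_field_derivative (exp (k * p0) * k)) (at p0)"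
    unfolding f_def by (auto intro!: derivative_eq_intros)
  then have "h p0 \<noteq> 0" using k by (simp add: h_def DERIV_imp_deriv)
  have "open (h -` (- {0}))"
    by (intro open_vimage holomorphic_on_imp_continuous_on[OF h]) auto
  have "y_coord lam C x - y_coord lam C x0 = h (proj lam x) * (proj lam x - proj lam x0)" for x
    by (simp add: y_coord_eq[OF assms(1)] h_def f_def k_def p0_def)
  with that[OF \<open>open (h -` (- {0}))\<close> _ holomorphic_on_subset[OF h subset_UNIV]] show ?thesis
    using \<open>h p0 \<noteq> 0\<close> by (simp add: p0_def)
qed

text \<open>
  Hence every line in the direction \<open>\<partial>\<^sub>\<tau>\<close> meets each slice \<open>t = const\<close> exactly once, for every choice.
\<close>

lemma tt_coord_flow:
  assumes "admissible \<Gamma> lam C" and "cmod lam \<noteq> 1"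
  shows "tt_coord lam C (x + r *\<^sub>R coord_field lam (0, 1)) = tt_coord lam C x + r"
proof -
  define n where "n = 1 + (cmod lam)\<^sup>2"
  define D where "D = (cmod (1 - g1 C * lam))\<^sup>2"
  define \<theta> where "\<theta> = coord_field lam (0, 1)"
  have n: "n > 0" using cmod_square_not_1[OF assms(2)] by (simp add: n_def)
  have D: "D \<noteq> 0" using one_minus_g1_nonzero[OF assms] by (simp add: D_def)
  have gl: "D = n - 2 * Re (g1 C * lam)"
    using cmod_one_minus_g1[OF assms(1)] by (simp add: D_def n_def)
  have T: "D * tt_coord lam C y = (1 - (cmod lam)\<^sup>2) * snd y - Im (((1 + (cmod lam)\<^sup>2) * g1 C - 2 * cnj lam) * fst y)" for y
    unfolding D_def by (rule tt_coord_eq[OF assms])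
  have \<theta>: "fst \<theta> = 2 * \<i> * lam / of_real n" "snd \<theta> = (1 - (cmod lam)\<^sup>2) / n"
    by (simp_all add: \<theta>_def coord_field_eq n_def)
  have im: "Im (((1 + (cmod lam)\<^sup>2) * g1 C - 2 * cnj lam) * fst \<theta>) = (2 * n * Re (g1 C * lam) - 4 * (cmod lam)\<^sup>2) / n"
  proof -
    have "(N * g1 C - 2 * cnj lam) * (2 * \<i> * lam / N) =
        (2 * \<i> * (N * (g1 C * lam)) - 4 * \<i> * (lam * cnj lam)) / N" for N
      unfolding times_divide_eq_right by (rule arg_cong[of _ _ "\<lambda>w. w / N"]) (simp add: algebra_simps)
    then have "((1 + (cmod lam)\<^sup>2) * g1 C - 2 * cnj lam) * fst \<theta> =
        (2 * \<i> * (of_real n * (g1 C * lam)) - 4 * \<i> * of_real ((cmod lam)\<^sup>2)) / of_real n"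
      unfolding \<theta> n_def complex_norm_square by blast
    then show ?thesis by (simp only: Im_divide_of_real) simp
  qed
  have "n * (m * (m / n) - q / n) = m\<^sup>2 - q" for m q :: real
    using n by (simp add: field_simps power2_eq_square)
  then have "n * (D * tt_coord lam C \<theta>) = (1 - (cmod lam)\<^sup>2)\<^sup>2 - (2 * n * Re (g1 C * lam) - 4 * (cmod lam)\<^sup>2)"
    unfolding T \<theta>(2) im .
  also have "\<dots> = n * D"
    unfolding gl n_def by algebra
  finally have "tt_coord lam C \<theta> = 1" using n D by simp
  moreover have "D * tt_coord lam C (x + r *\<^sub>R \<theta>) = D * (tt_coord lam C x + r * tt_coord lam C \<theta>)"
    unfolding distrib_left mult.left_commute[of D r] T by (simp add: algebra_simps)
  ultimately show ?thesis using D by (simp add: \<theta>_def)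
qed

lemma continuous_on_tt_coord: "continuous_on A (tt_coord lam C)"
  unfolding tt_coord_def divide_inverse by (intro continuous_intros)

text \<open>
  The coefficients of \<open>l\<close> are recovered from \<open>Im (cnj a * l)\<close> and \<open>Im (cnj b * l)\<close>, hence bounded in
  terms of \<open>cmod l\<close>.
\<close>

lemma finite_lattice_bounded:
  assumes "Im (cnj a * b) \<noteq> 0"
  shows "finite {l. (\<exists>m n::int. l = of_int m * a + of_int n * b) \<and> cmod l \<le> R}"
proof -
  define A where "A = \<bar>Im (cnj a * b)\<bar>"
  define N where "N = \<lceil>(cmod a + cmod b) * R / A\<rceil>"
  have A: "A > 0" using assms by (simp add: A_def)
  have "{l. (\<exists>m n::int. l = of_int m * a + of_int n * b) \<and> cmod l \<le> R}
      \<subseteq> (\<lambda>(m, n). of_int m * a + of_int n * b) ` ({-N..N} \<times> {-N..N})"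
  proof clarify
    fix m n :: int
    define l where "l = of_int m * a + of_int n * b"
    assume "cmod (of_int m * a + of_int n * b) \<le> R"
    then have l: "cmod l \<le> R" by (simp add: l_def)
    have bd: "\<bar>Im (cnj c * l)\<bar> \<le> (cmod a + cmod b) * R" if "c = a \<or> c = b" for c
    proof -
      have "\<bar>Im (cnj c * l)\<bar> \<le> cmod c * cmod l"
        using abs_Im_le_cmod[of "cnj c * l"] by (simp add: norm_mult)
      also have "\<dots> \<le> (cmod a + cmod b) * R"
        using that l by (intro mult_mono) auto
      finally show ?thesis .
    qed
    have "Im (cnj a * l) = of_int n * Im (cnj a * b)" "Im (cnj b * l) = - of_int m * Im (cnj a * b)"
      by (simp_all add: l_def algebra_simps)
    then have "\<bar>real_of_int n\<bar> * A \<le> (cmod a + cmod b) * R" "\<bar>real_of_int m\<bar> * A \<le> (cmod a + cmod b) * R"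
      using bd[of a] bd[of b] by (simp_all add: A_def abs_mult)
    then have "\<bar>real_of_int n\<bar> \<le> (cmod a + cmod b) * R / A" "\<bar>real_of_int m\<bar> \<le> (cmod a + cmod b) * R / A"
      using A by (simp_all add: pos_le_divide_eq)
    then have "\<bar>n\<bar> \<le> N" "\<bar>m\<bar> \<le> N"
      unfolding N_def by linarith+
    then show "of_int m * a + of_int n * b \<in> (\<lambda>(m, n). of_int m * a + of_int n * b) ` ({-N..N} \<times> {-N..N})"
      by (intro rev_image_eqI[of "(m, n)"]) auto
  qed
  then show ?thesis by (rule finite_subset) auto
qed

text \<open>
  The divisor is a finite union of translates of the lattice of the elliptic curve, whose oriented
  area is \<open>1 - \<bar>\<lambda>\<bar>\<^sup>4\<close> times the area of \<open>\<Gamma>\<close>. The factor does not vanish for \<open>\<bar>\<lambda>\<bar> \<noteq> 1\<close>.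
\<close>

lemma divisor_isolated:
  assumes \<Gamma>: "oriented_basis \<Gamma> \<mu>1 \<mu>2" and lam: "cmod lam \<noteq> 1" and Z: "finite Z"
  obtains \<epsilon> where "\<epsilon> > 0" "\<And>P. P \<in> divisor \<Gamma> Z lam \<Longrightarrow> dist p P < \<epsilon> \<Longrightarrow> P = p"
proof -
  define a b where "a = \<mu>1 + lam\<^sup>2 * cnj \<mu>1" and "b = \<mu>2 + lam\<^sup>2 * cnj \<mu>2"
  have "Im (cnj a * b) = (1 - (cmod lam)\<^sup>2) * (1 + (cmod lam)\<^sup>2) * Im (cnj \<mu>1 * \<mu>2)"
    using Im_period_product[of \<mu>2 lam \<mu>1] by (simp only: a_def b_def mult.commute)
  then have "Im (cnj a * b) \<noteq> 0"
    using cmod_square_not_1[OF lam] area_pos[OF \<Gamma>] by simp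
  note fin = finite_lattice_bounded[OF this]
  define F where "F = (\<Union>z\<in>Z. (\<lambda>l. proj lam z + l) `
    {l. (\<exists>m n::int. l = of_int m * a + of_int n * b) \<and> cmod l \<le> 1 + dist p (proj lam z)})"
  have "finite F" unfolding F_def by (intro finite_UN_I Z finite_imageI fin)
  from finite_set_avoid[OF this, of p] obtain d where d: "d > 0" "\<forall>x\<in>F. x \<noteq> p \<longrightarrow> d \<le> dist p x"
    by blast
  have "P \<in> F" if "P \<in> divisor \<Gamma> Z lam" "dist p P < 1" for P
  proof -
    from that(1) obtain \<gamma> z where z: "z \<in> Z" "\<gamma> \<in> \<Gamma>" and P: "P = proj lam z + (\<gamma> + lam\<^sup>2 * cnj \<gamma>)"
      by (auto simp: divisor_def saturate_def proj_shift)
    from z(2) obtain m n :: int where mn: "\<gamma> = of_int m * \<mu>1 + of_int n * \<mu>2"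
      using \<Gamma> by (auto simp: oriented_basis_def)
    have "\<gamma> + lam\<^sup>2 * cnj \<gamma> = of_int m * a + of_int n * b"
      by (simp add: mn a_def b_def algebra_simps)
    moreover have "dist P (proj lam z) \<le> 1 + dist p (proj lam z)"
      using that(2) dist_triangle[of P "proj lam z" p] by (simp add: dist_commute)
    then have "cmod (\<gamma> + lam\<^sup>2 * cnj \<gamma>) \<le> 1 + dist p (proj lam z)"
      by (simp add: P dist_norm)
    ultimately show ?thesis unfolding F_def P using z(1) by blast
  qed
  with d have "P = p" if "P \<in> divisor \<Gamma> Z lam" "dist p P < min 1 d" for P
    using that by force
  then show ?thesis using that[of "min 1 d"] d(1) by simp
qed

section \<open>Mini-holomorphic sections and their flat transport\<close>

lemma matrix_inv_inverse:
  fixes A :: "complex^'n^'n"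
  assumes "invertible A"
  shows "A ** matrix_inv A = mat 1" "matrix_inv A ** A = mat 1"
  using someI_ex[OF assms[unfolded invertible_def]] unfolding matrix_inv_def by auto

lemma matrix_vector_mult_sum:
  fixes A :: "complex^'n^'m"
  shows "A *v (\<Sum>j\<in>J. v j) = (\<Sum>j\<in>J. A *v v j)"
  by (induction J rule: infinite_finite_induct) (simp_all add: matrix_vector_right_distrib)

lemma column_matrix_mult: "column j (A ** B) = A *v column j B"
  by (simp add: vec_eq_iff column_def matrix_matrix_mult_def matrix_vector_mult_def)

lemma bounded_linear_column: "bounded_linear (column j :: complex^'n^'n \<Rightarrow> complex^'n)"
proof -
  have "linear (column j :: complex^'n^'n \<Rightarrow> complex^'n)"
    by (rule linearI) (simp_all add: column_def vec_eq_iff)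
  then show ?thesis by (simp add: linear_conv_bounded_linear)
qed

context
  fixes \<Gamma> Z and M :: "'r::finite monopole"
  assumes mon: "monopole_on \<Gamma> Z M"
begin

lemma atlas: "vector_bundle_atlas \<Gamma> Z (frames M)"
  using mon by (simp add: monopole_on_def)

lemma frame_open:
  assumes "(U, e) \<in> frames M"
  shows "open U" "U \<subseteq> reg \<Gamma> Z" "x \<in> U \<Longrightarrow> invertible (e x)"
proof -
  have "open U \<and> periodic_set \<Gamma> U \<and> (\<forall>x\<in>U. invertible (e x) \<and> (\<forall>\<gamma>\<in>\<Gamma>. e (shift \<gamma> x) = e x))"
    using bspec[OF atlas[unfolded vector_bundle_atlas_def, THEN conjunct2, THEN conjunct1] assms] by simp
  then show "open U" "x \<in> U \<Longrightarrow> invertible (e x)" by auto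
  have "U \<subseteq> \<Union>(fst ` frames M)" using imageI[OF assms, of fst] by auto
  then show "U \<subseteq> reg \<Gamma> Z" using atlas unfolding vector_bundle_atlas_def by simp
qed

lemma obtain_frame:
  assumes "x \<in> reg \<Gamma> Z"
  obtains U e where "(U, e) \<in> frames M" "x \<in> U"
proof -
  have "x \<in> \<Union>(fst ` frames M)" using assms atlas by (simp add: vector_bundle_atlas_def)
  then obtain b where "b \<in> frames M" "x \<in> fst b" by blast
  then show ?thesis using that[of "fst b" "snd b"] by simp
qed

lemma smooth_sectI:
  assumes "\<And>U e. (U, e) \<in> frames M \<Longrightarrow> open U \<Longrightarrow> smooth_on (V \<inter> U) (\<lambda>x. matrix_inv (e x) *v s x)"
  shows "smooth_sect M V s"
  unfolding smooth_sect_def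
proof (rule ballI, rule prod.case_eq_if[THEN iffD2])
  fix b assume "b \<in> frames M"
  then show "smooth_on (V \<inter> fst b) (\<lambda>x. matrix_inv (snd b x) *v s x)"
    using assms[of "fst b" "snd b"] frame_open(1)[of "fst b" "snd b"] by simp
qed

lemma smooth_sect_add:
  assumes "open V" "smooth_sect M V s" "smooth_sect M V t"
  shows "smooth_sect M V (\<lambda>x. s x + t x)"
proof (rule smooth_sectI)
  fix U e assume e: "(U, e) \<in> frames M" "open U"
  show "smooth_on (V \<inter> U) (\<lambda>x. matrix_inv (e x) *v (s x + t x))"
    unfolding matrix_vector_right_distrib
    by (intro smooth_on_add smooth_sectD[OF _ e(1)] assms open_Int e)
qed

lemma smooth_sect_scale:
  assumes "open V" "smooth_on V f" "smooth_sect M V s"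
  shows "smooth_sect M V (\<lambda>x. f x *s s x)"
proof (rule smooth_sectI)
  fix U e assume e: "(U, e) \<in> frames M" "open U"
  have "smooth_on (V \<inter> U) f" using assms(2) by (rule smooth_on_subset) simp
  then show "smooth_on (V \<inter> U) (\<lambda>x. matrix_inv (e x) *v (f x *s s x))"
    unfolding vector_scalar_commute
    by (intro smooth_on_vector_scalar_mult smooth_sectD[OF _ e(1)] assms open_Int e)
qed

lemma smooth_sect_higgs:
  assumes "open V" "V \<subseteq> reg \<Gamma> Z" "smooth_sect M V s"
  shows "smooth_sect M V (\<lambda>x. higgs M x *v s x)"
proof -
  have "anti_self_adjoint_endomorphism \<Gamma> Z M" using mon by (simp add: monopole_on_def)
  then have "open V \<and> V \<subseteq> reg \<Gamma> Z \<and> smooth_sect M V s \<longrightarrow> smooth_sect M V (\<lambda>x. higgs M x *v s x)"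
    unfolding anti_self_adjoint_endomorphism_def by (elim conjE allE)
  with assms show ?thesis by simp
qed

lemma connection_rules:
  assumes "open V" "V \<subseteq> reg \<Gamma> Z" "smooth_sect M V s"
  shows smooth_sect_conn: "smooth_sect M V (conn M v s)"
    and conn_cong: "smooth_sect M V s' \<Longrightarrow> (\<And>x. x \<in> V \<Longrightarrow> s x = s' x) \<Longrightarrow> x \<in> V \<Longrightarrow> conn M v s x = conn M v s' x"
    and conn_add: "smooth_sect M V s' \<Longrightarrow> x \<in> V \<Longrightarrow> conn M v (\<lambda>x. s x + s' x) x = conn M v s x + conn M v s' x"
    and conn_scale: "smooth_on V f \<Longrightarrow> x \<in> V \<Longrightarrow>
      conn M v (\<lambda>x. f x *s s x) x = frechet_derivative f (at x) v *s s x + f x *s conn M v s x"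
proof -
  have c: "connection \<Gamma> Z M" using mon by (simp add: monopole_on_def unitary_connection_def)
  note c = c[unfolded connection_def, rule_format, OF conjI[OF assms(1,2)] assms(3)]
  show "smooth_sect M V (conn M v s)" using c by blast
  show "smooth_sect M V s' \<Longrightarrow> (\<And>x. x \<in> V \<Longrightarrow> s x = s' x) \<Longrightarrow> x \<in> V \<Longrightarrow> conn M v s x = conn M v s' x"
    using c by blast
  show "smooth_sect M V s' \<Longrightarrow> x \<in> V \<Longrightarrow> conn M v (\<lambda>x. s x + s' x) x = conn M v s x + conn M v s' x"
    using c by blast
  show "smooth_on V f \<Longrightarrow> x \<in> V \<Longrightarrow>
      conn M v (\<lambda>x. f x *s s x) x = frechet_derivative f (at x) v *s s x + f x *s conn M v s x"
    using c by blast
qed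

lemma conn_sum:
  assumes "finite J" "J \<noteq> {}" "open V" "V \<subseteq> reg \<Gamma> Z" "\<And>j. j \<in> J \<Longrightarrow> smooth_sect M V (s j)"
  shows "smooth_sect M V (\<lambda>x. \<Sum>j\<in>J. s j x) \<and>
     (\<forall>x\<in>V. conn M v (\<lambda>x. \<Sum>j\<in>J. s j x) x = (\<Sum>j\<in>J. conn M v (s j) x))"
  using assms(1,2,5)
proof (induction J rule: finite_ne_induct)
  case (singleton j)
  then show ?case by simp
next
  case (insert j J)
  then have "smooth_sect M V (s j)" and "smooth_sect M V (\<lambda>x. \<Sum>j\<in>J. s j x)"
    and "\<And>x. x \<in> V \<Longrightarrow> conn M v (\<lambda>x. \<Sum>j\<in>J. s j x) x = (\<Sum>j\<in>J. conn M v (s j) x)"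
    by auto
  with insert show ?case
    using conn_add[OF assms(3,4)] smooth_sect_add[OF assms(3)] by simp
qed

lemma minihol_add:
  assumes "open V" "V \<subseteq> reg \<Gamma> Z" "minihol M lam V s" "minihol M lam V t"
  shows "minihol M lam V (\<lambda>x. s x + t x)"
proof -
  have s: "smooth_sect M V s" and t: "smooth_sect M V t"
    using assms by (auto simp: minihol_def)
  have "nabla_alpha_bar M lam (\<lambda>x. s x + t x) x = nabla_alpha_bar M lam s x + nabla_alpha_bar M lam t x"
    and "nabla_tau M lam (\<lambda>x. s x + t x) x = nabla_tau M lam s x + nabla_tau M lam t x" if "x \<in> V" for x
    unfolding nabla_alpha_bar_def nabla_tau_def conn_add[OF assms(1,2) s t that]
    by (simp_all add: vec_eq_iff algebra_simps)
  moreover have "\<i> *s (higgs M x *v (s x + t x)) = \<i> *s (higgs M x *v s x) + \<i> *s (higgs M x *v t x)" for x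
    by (simp add: matrix_vector_right_distrib vector_add_ldistrib)
  ultimately show ?thesis
    using assms(3,4) smooth_sect_add[OF assms(1) s t] by (simp add: minihol_def)
qed

text \<open>
  Holomorphic functions of \<open>proj\<close> are killed by both \<open>\<partial>/\<partial>cnj \<alpha>\<close> and \<open>\<partial>\<^sub>\<tau>\<close>, so multiplication by them
  commutes with the two operators that define mini-holomorphic sections.
\<close>

lemma minihol_scale:
  assumes "open V" "V \<subseteq> reg \<Gamma> Z" "minihol M lam V s"
    and "h holomorphic_on S" "open S" "proj lam ` V \<subseteq> S"
  shows "minihol M lam V (\<lambda>x. h (proj lam x) *s s x)"
proof -
  have s: "smooth_sect M V s" using assms by (simp add: minihol_def)
  have h: "smooth_on V (\<lambda>x. h (proj lam x))"
    using smooth_on_holomorphic_compose_linear[OF bounded_linear_proj[of lam] assms(5,4)]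
    by (rule smooth_on_subset) (use assms(6) in auto)
  have "nabla_alpha_bar M lam (\<lambda>x. h (proj lam x) *s s x) x = 0 \<and>
     nabla_tau M lam (\<lambda>x. h (proj lam x) *s s x) x - \<i> *s (higgs M x *v (h (proj lam x) *s s x)) = 0"
    if x: "x \<in> V" for x
  proof -
    have "proj lam x \<in> S" using x assms(6) by auto
    note der = frechet_derivative_at[OF has_derivative_holomorphic_compose_linear[OF bounded_linear_proj assms(4,5) this], symmetric]
    have c: "conn M (coord_field lam (a, t)) (\<lambda>x. h (proj lam x) *s s x) x =
        (deriv h (proj lam x) * (of_real (1 + (cmod lam)\<^sup>2) * a)) *s s x + h (proj lam x) *s conn M (coord_field lam (a, t)) s x" for a t
      using conn_scale[OF assms(1,2) s h x] by (simp add: der proj_coord_field)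
    have 0: "nabla_alpha_bar M lam s x = 0" "nabla_tau M lam s x - \<i> *s (higgs M x *v s x) = 0"
      using assms(3) x by (auto simp: minihol_def)
    have "nabla_alpha_bar M lam (\<lambda>x. h (proj lam x) *s s x) x = h (proj lam x) *s nabla_alpha_bar M lam s x"
      unfolding nabla_alpha_bar_def c by (simp add: vec_eq_iff algebra_simps)
    moreover have "nabla_tau M lam (\<lambda>x. h (proj lam x) *s s x) x - \<i> *s (higgs M x *v (h (proj lam x) *s s x)) =
        h (proj lam x) *s (nabla_tau M lam s x - \<i> *s (higgs M x *v s x))"
      unfolding nabla_tau_def c vector_scalar_commute by (simp add: vec_eq_iff algebra_simps)
    ultimately show ?thesis unfolding 0 by simp
  qed
  then show ?thesis
    using smooth_sect_scale[OF assms(1) h s] by (simp add: minihol_def)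
qed

lemma minihol_diff:
  assumes "open V" "V \<subseteq> reg \<Gamma> Z" "minihol M lam V s" "minihol M lam V t"
  shows "minihol M lam V (\<lambda>x. s x - t x)"
proof -
  have "minihol M lam V (\<lambda>x. (-1) *s t x)"
    using minihol_scale[OF assms(1,2,4), of "\<lambda>_. -1" UNIV] by simp
  from minihol_add[OF assms(1-3) this] show ?thesis
    by simp
qed

end

context
  fixes \<Gamma> Z and M :: "'r::finite monopole"
  assumes mon: "monopole_on \<Gamma> Z M"
begin

lemma smooth_sect_frame_column:
  assumes e: "(U, e) \<in> frames M"
  shows "smooth_sect M U (\<lambda>x. column j (e x))"
proof (rule smooth_sectI[OF mon])
  fix U' e' assume e': "(U', e') \<in> frames M" "open U'"
  note trans = atlas[OF mon, unfolded vector_bundle_atlas_def, THEN conjunct2, THEN conjunct2]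
  have "smooth_on (U' \<inter> U) (\<lambda>x. matrix_inv (e' x) ** e x)"
    using bspec[OF trans e'(1)] e by (auto dest!: bspec)
  then have "smooth_on (U \<inter> U') (\<lambda>x. column j (matrix_inv (e' x) ** e x))"
    by (intro smooth_on_bounded_linear[OF bounded_linear_column] open_Int e'(2) frame_open(1)[OF mon e])
      (simp add: Int_commute)
  then show "smooth_on (U \<inter> U') (\<lambda>x. matrix_inv (e' x) *v column j (e x))"
    by (simp add: column_matrix_mult)
qed

text \<open>
  The \<open>j\<close>-th column of the matrix, in the frame \<open>e\<close>, of the zeroth order term of \<open>-(\<nabla>\<^sub>\<tau> - \<i> \<phi>)\<close>.
\<close>

definition tau_coeff :: "complex \<Rightarrow> (pt \<Rightarrow> complex^'r^'r) \<Rightarrow> 'r \<Rightarrow> pt \<Rightarrow> complex^'r" where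
  "tau_coeff lam e j x = \<i> *s (matrix_inv (e x) *v (higgs M x *v column j (e x)))
     - matrix_inv (e x) *v conn M (coord_field lam (0, 1)) (\<lambda>x. column j (e x)) x"

lemma continuous_on_tau_coeff:
  assumes e: "(U, e) \<in> frames M"
  shows "continuous_on U (tau_coeff lam e j)"
proof -
  note U = frame_open[OF mon e]
  note E = smooth_sect_frame_column[OF e]
  have "continuous_on U (\<lambda>x. matrix_inv (e x) *v (higgs M x *v column j (e x)))"
    using smooth_sectD[OF smooth_sect_higgs[OF mon U(1,2) E] e, of j] by (simp add: smooth_on_imp_continuous_on)
  moreover have "continuous_on U (\<lambda>x. matrix_inv (e x) *v conn M (coord_field lam (0, 1)) (\<lambda>x. column j (e x)) x)"
    using smooth_sectD[OF smooth_sect_conn[OF mon U(1,2) E] e, of _ j] by (simp add: smooth_on_imp_continuous_on)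
  ultimately show ?thesis
    unfolding tau_coeff_def
    by (intro continuous_on_diff bounded_bilinear.continuous_on[OF bounded_bilinear_vector_scalar_mult] continuous_on_const)
qed

text \<open>
  Written in a frame, the equation \<open>\<nabla>\<^sub>\<tau> s = \<i> \<phi> s\<close> becomes a linear ordinary differential equation with
  continuous coefficients along the lines in the direction \<open>\<partial>\<^sub>\<tau>\<close>.
\<close>

lemma minihol_frame_equation:
  assumes e: "(U, e) \<in> frames M" and W: "open W" "W \<subseteq> U" and s: "minihol M lam W s" and x: "x \<in> W"
  defines "c \<equiv> \<lambda>x. matrix_inv (e x) *v s x"
  shows "c differentiable (at x)"
    and "frechet_derivative c (at x) (coord_field lam (0, 1)) = (\<Sum>j\<in>UNIV. c x $ j *s tau_coeff lam e j x)"
proof -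
  let ?\<theta> = "coord_field lam (0, 1)"
  let ?E = "\<lambda>j x. column j (e x)"
  note U = frame_open[OF mon e]
  have W': "W \<subseteq> reg \<Gamma> Z" using U(2) W(2) by blast
  have ss: "smooth_sect M W s" using s by (simp add: minihol_def)
  have E: "smooth_sect M W (?E j)" for j
    using smooth_sect_frame_column[OF e] W(2) by (rule smooth_sect_subset)
  have c: "smooth_on W c"
    using smooth_sectD[OF ss e] W(2) unfolding c_def by (simp add: inf_absorb1)
  show cd: "c differentiable (at x)"
    using c x by (rule smooth_on_imp_differentiable)
  have cj: "smooth_on W (\<lambda>x. c x $ j)" for j
    using smooth_on_bounded_linear[OF bounded_linear_vec_nth W(1) c] .
  have dcj: "frechet_derivative (\<lambda>x. c x $ j) (at x) v = frechet_derivative c (at x) v $ j" for j v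
    using frechet_derivative_at[OF bounded_linear.has_derivative[OF bounded_linear_vec_nth
      cd[unfolded frechet_derivative_works]], of j] by metis
  have inv: "e y *v (matrix_inv (e y) *v v) = v" "matrix_inv (e y) *v (e y *v v) = v" if "y \<in> W" for y v
    using matrix_inv_inverse[OF U(3), of y] that W(2) by (auto simp: matrix_vector_mul_assoc)
  have s_eq: "s y = (\<Sum>j\<in>UNIV. c y $ j *s ?E j y)" if "y \<in> W" for y
    using inv(1)[OF that, of "s y"] unfolding c_def by (simp add: matrix_mult_sum[of "e y"])
  have sum: "smooth_sect M W (\<lambda>x. \<Sum>j\<in>UNIV. c x $ j *s ?E j x)"
    "conn M ?\<theta> (\<lambda>x. \<Sum>j\<in>UNIV. c x $ j *s ?E j x) x = (\<Sum>j\<in>UNIV. conn M ?\<theta> (\<lambda>x. c x $ j *s ?E j x) x)"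
    using conn_sum[OF mon finite UNIV_not_empty W(1) W', of "\<lambda>j x. c x $ j *s ?E j x" ?\<theta>]
      smooth_sect_scale[OF mon W(1) cj E] x by auto
  have "conn M ?\<theta> s x = conn M ?\<theta> (\<lambda>x. \<Sum>j\<in>UNIV. c x $ j *s ?E j x) x"
    using s_eq by (intro conn_cong[OF mon W(1) W' ss sum(1) _ x]) auto
  also have "\<dots> = (\<Sum>j\<in>UNIV. frechet_derivative c (at x) ?\<theta> $ j *s ?E j x + c x $ j *s conn M ?\<theta> (?E j) x)"
    unfolding sum(2) conn_scale[OF mon W(1) W' E cj x] dcj by (rule refl)
  also have "\<dots> = e x *v frechet_derivative c (at x) ?\<theta> + (\<Sum>j\<in>UNIV. c x $ j *s conn M ?\<theta> (?E j) x)"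
    by (simp add: sum.distrib matrix_mult_sum[of "e x"])
  finally have 1: "conn M ?\<theta> s x = \<dots>" .
  have "conn M ?\<theta> s x = \<i> *s (higgs M x *v s x)"
    using s x unfolding minihol_def nabla_tau_def by auto
  also have "\<dots> = (\<Sum>j\<in>UNIV. c x $ j *s (\<i> *s (higgs M x *v ?E j x)))"
    unfolding s_eq[OF x]
    by (simp add: matrix_vector_mult_sum vector_scalar_commute vec.scale_sum_right mult.commute[of \<i>])
  finally have "e x *v frechet_derivative c (at x) ?\<theta> =
      (\<Sum>j\<in>UNIV. c x $ j *s (\<i> *s (higgs M x *v ?E j x) - conn M ?\<theta> (?E j) x))"
    unfolding 1 by (simp add: sum_subtractf vec.scale_right_diff_distrib eq_diff_eq)
  then have "matrix_inv (e x) *v (e x *v frechet_derivative c (at x) ?\<theta>) =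
      matrix_inv (e x) *v (\<Sum>j\<in>UNIV. c x $ j *s (\<i> *s (higgs M x *v ?E j x) - conn M ?\<theta> (?E j) x))"
    by simp
  then show "frechet_derivative c (at x) ?\<theta> = (\<Sum>j\<in>UNIV. c x $ j *s tau_coeff lam e j x)"
    unfolding inv(2)[OF x] tau_coeff_def
    by (simp add: matrix_vector_mult_sum vector_scalar_commute matrix_vector_right_distrib matrix_vector_mult_diff_distrib)
qed

text \<open>
  Uniqueness of flat transport. On a short segment on which \<open>s\<close> vanishes at an end point, let \<open>m\<close> be the
  maximum of the norm of the coordinates of \<open>s\<close>. By the differential equation their derivative is bounded
  by \<open>m K\<close>, so by the mean value theorem \<open>m\<close> is at most \<open>m K\<close> times the length, which is at most
  \<open>m / 2\<close>. The radius is chosen before the section and its domain \<open>W\<close>, because the lemma is applied on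
  domains from which the fibre of \<open>proj\<close> through \<open>x\<^sub>0\<close> has been removed.
\<close>

lemma minihol_flat_unique:
  assumes x0: "x0 \<in> reg \<Gamma> Z"
  obtains \<rho> where "\<rho> > 0" "ball x0 \<rho> \<subseteq> reg \<Gamma> Z"
    "\<And>W s x r. open W \<Longrightarrow> W \<subseteq> ball x0 \<rho> \<Longrightarrow> minihol M lam W s \<Longrightarrow>
       (\<And>t. t \<in> closed_segment 0 r \<Longrightarrow> x + t *\<^sub>R coord_field lam (0, 1) \<in> W) \<Longrightarrow>
       s x = 0 \<Longrightarrow> s (x + r *\<^sub>R coord_field lam (0, 1)) = 0"
proof -
  let ?\<theta> = "coord_field lam (0, 1)"
  obtain U e where e: "(U, e) \<in> frames M" and "x0 \<in> U"
    using obtain_frame[OF mon x0] .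
  note U = frame_open[OF mon e]
  have "\<exists>K \<rho>. K > 0 \<and> \<rho> > 0 \<and> ball x0 \<rho> \<subseteq> U \<and> (\<forall>x\<in>ball x0 \<rho>. (\<Sum>j\<in>UNIV. norm (tau_coeff lam e j x)) \<le> K)"
  proof -
    let ?f = "\<lambda>x. \<Sum>j\<in>UNIV. norm (tau_coeff lam e j x)"
    have "continuous_on U ?f"
      by (intro continuous_intros continuous_on_tau_coeff[OF e])
    then have "open (U \<inter> ?f -` {..< ?f x0 + 1})"
      by (intro continuous_open_preimage U(1) open_lessThan)
    moreover have "x0 \<in> U \<inter> ?f -` {..< ?f x0 + 1}"
      using \<open>x0 \<in> U\<close> by simp
    ultimately obtain \<rho> where \<rho>: "\<rho> > 0" "ball x0 \<rho> \<subseteq> U \<inter> ?f -` {..< ?f x0 + 1}"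
      by (rule openE)
    moreover have "?f x0 + 1 > 0"
      by (smt (verit) norm_ge_zero sum_nonneg)
    moreover have "?f x \<le> ?f x0 + 1" if "x \<in> ball x0 \<rho>" for x
    proof -
      have "x \<in> ?f -` {..< ?f x0 + 1}" using \<rho>(2) that by blast
      then show ?thesis by simp
    qed
    moreover have "ball x0 \<rho> \<subseteq> U" using \<rho>(2) by blast
    ultimately show ?thesis using \<rho>(1) by blast
  qed
  then obtain K \<rho>1 where K: "K > 0" "\<rho>1 > 0" "ball x0 \<rho>1 \<subseteq> U"
    "\<And>x. x \<in> ball x0 \<rho>1 \<Longrightarrow> (\<Sum>j\<in>UNIV. norm (tau_coeff lam e j x)) \<le> K" by auto
  have \<theta>: "norm ?\<theta> > 0" using coord_field_tau_nonzero by simp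
  \<comment> \<open>A segment inside the ball has parameter length below \<open>2 \<rho> / norm \<theta> \<le> 1 / (2 K)\<close>, which makes the
    mean value estimate at the end contracting.\<close>
  define \<rho> where "\<rho> = min \<rho>1 (norm ?\<theta> / (4 * K))"
  have \<rho>\<rho>1: "ball x0 \<rho> \<subseteq> ball x0 \<rho>1" unfolding \<rho>_def by (intro subset_ball min.cobounded1)
  show ?thesis
  proof (rule that)
    show "\<rho> > 0" using K \<theta> by (simp add: \<rho>_def)
    show "ball x0 \<rho> \<subseteq> reg \<Gamma> Z" using K(3) U(2) \<rho>\<rho>1 by blast
    fix W s x r
    assume W: "open W" "W \<subseteq> ball x0 \<rho>" and s: "minihol M lam W s"
      and seg: "\<And>t. t \<in> closed_segment 0 r \<Longrightarrow> x + t *\<^sub>R ?\<theta> \<in> W" and "s x = 0"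
    have WU: "W \<subseteq> U" using W(2) K(3) \<rho>\<rho>1 by blast
    define c where "c = (\<lambda>x. matrix_inv (e x) *v s x)"
    define \<gamma> where "\<gamma> = (\<lambda>t. c (x + t *\<^sub>R ?\<theta>))"
    let ?S = "closed_segment 0 r"
    let ?\<gamma>' = "\<lambda>t. \<Sum>j\<in>UNIV. \<gamma> t $ j *s tau_coeff lam e j (x + t *\<^sub>R ?\<theta>)"
    have der: "(\<gamma> has_derivative (\<lambda>h. h *\<^sub>R ?\<gamma>' t)) (at t within ?S)" if "t \<in> ?S" for t
    proof -
      note eq = minihol_frame_equation(1)[OF e W(1) WU s seg[OF that], folded c_def]
      have line: "((\<lambda>t. x + t *\<^sub>R ?\<theta>) has_derivative (\<lambda>h. h *\<^sub>R ?\<theta>)) (at t)"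
        by (auto intro!: derivative_eq_intros)
      have "(\<gamma> has_derivative (\<lambda>h. frechet_derivative c (at (x + t *\<^sub>R ?\<theta>)) (h *\<^sub>R ?\<theta>))) (at t)"
        unfolding \<gamma>_def using has_derivative_compose[OF line eq[unfolded frechet_derivative_works]] .
      moreover have "linear (frechet_derivative c (at (x + t *\<^sub>R ?\<theta>)))"
        using eq by (rule linear_frechet_derivative)
      moreover have "frechet_derivative c (at (x + t *\<^sub>R ?\<theta>)) ?\<theta> = ?\<gamma>' t"
        using minihol_frame_equation(2)[OF e W(1) WU s seg[OF that]] by (simp add: \<gamma>_def c_def)
      ultimately have "(\<gamma> has_derivative (\<lambda>h. h *\<^sub>R ?\<gamma>' t)) (at t)"
        by (simp only: linear_cmul)
      then show ?thesis by (rule has_derivative_at_withinI)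
    qed
    have "continuous_on ?S \<gamma>"
      using der by (meson continuous_on_eq_continuous_within has_derivative_continuous)
    then obtain t1 where t1: "t1 \<in> ?S" "\<And>t. t \<in> ?S \<Longrightarrow> norm (\<gamma> t) \<le> norm (\<gamma> t1)"
      using continuous_attains_sup[of ?S "\<lambda>t. norm (\<gamma> t)"] by (auto intro: continuous_on_norm)
    define m where "m = norm (\<gamma> t1)"
    have bd: "norm (?\<gamma>' t) \<le> m * K" if "t \<in> ?S" for t
    proof -
      have "norm (?\<gamma>' t) \<le> (\<Sum>j\<in>UNIV. norm (\<gamma> t $ j *s tau_coeff lam e j (x + t *\<^sub>R ?\<theta>)))"
        by (rule norm_sum)
      also have "\<dots> \<le> (\<Sum>j\<in>UNIV. m * norm (tau_coeff lam e j (x + t *\<^sub>R ?\<theta>)))"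
      proof (rule sum_mono)
        fix j
        have "norm (\<gamma> t $ j) \<le> m"
          using Finite_Cartesian_Product.norm_nth_le[of "\<gamma> t" j] t1(2)[OF that] by (simp add: m_def)
        then show "norm (\<gamma> t $ j *s tau_coeff lam e j (x + t *\<^sub>R ?\<theta>)) \<le> m * norm (tau_coeff lam e j (x + t *\<^sub>R ?\<theta>))"
          by (simp add: norm_vector_scalar_mult mult_right_mono)
      qed
      also have "\<dots> \<le> m * K"
        unfolding sum_distrib_left[symmetric] m_def
        by (intro mult_left_mono K(4) norm_ge_zero) (use seg[OF that] W(2) \<rho>\<rho>1 in blast)
      finally show ?thesis .
    qed
    have "0 \<in> ?S" "r \<in> ?S" by auto
    have "norm (\<gamma> t1 - \<gamma> 0) \<le> (m * K) * norm (t1 - 0)"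
    proof (rule differentiable_bound[OF convex_closed_segment der])
      fix t assume "t \<in> ?S"
      then show "onorm (\<lambda>h. h *\<^sub>R ?\<gamma>' t) \<le> m * K"
        using bd by (intro onorm_le) (simp add: mult.commute[of _ "\<bar>_\<bar>"] mult_left_mono)
    qed (use t1 \<open>0 \<in> ?S\<close> in auto)
    moreover have "\<gamma> 0 = 0" using \<open>s x = 0\<close> by (simp add: \<gamma>_def c_def)
    moreover have "\<bar>t1\<bar> * K \<le> 1 / 2"
    proof -
      have "x \<in> ball x0 \<rho>" "x + t1 *\<^sub>R ?\<theta> \<in> ball x0 \<rho>"
        using seg[OF t1(1)] seg[OF \<open>0 \<in> ?S\<close>] W(2) by auto
      then have "dist x (x + t1 *\<^sub>R ?\<theta>) < 2 * \<rho>"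
        by (smt (verit) dist_triangle mem_ball dist_commute)
      then have "\<bar>t1\<bar> * norm ?\<theta> < 2 * \<rho>" by (simp add: dist_norm)
      also have "\<dots> \<le> norm ?\<theta> / (2 * K)"
        using min.cobounded2[of \<rho>1 "norm ?\<theta> / (4 * K)"] by (simp add: \<rho>_def)
      finally have "\<bar>t1\<bar> * K * norm ?\<theta> < norm ?\<theta> * (1/2)"
        using K(1) by (simp add: field_simps)
      then have "norm ?\<theta> * (\<bar>t1\<bar> * K) < norm ?\<theta> * (1/2)" by (simp only: mult_ac)
      then show ?thesis using \<theta> by (metis less_eq_real_def mult_less_cancel_left_pos)
    qed
    ultimately have "m \<le> m * (1 / 2)"
      unfolding m_def by (smt (verit) diff_zero mult.assoc mult.commute mult_left_mono norm_ge_zero real_norm_def)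
    then have "m \<le> 0" by simp
    then have "\<gamma> r = 0" using t1(2)[OF \<open>r \<in> ?S\<close>] by (simp add: m_def)
    then have "e (x + r *\<^sub>R ?\<theta>) *v (matrix_inv (e (x + r *\<^sub>R ?\<theta>)) *v s (x + r *\<^sub>R ?\<theta>)) = 0"
      by (simp add: \<gamma>_def c_def)
    then show "s (x + r *\<^sub>R ?\<theta>) = 0"
      using matrix_inv_inverse(1)[OF U(3)[OF subsetD[OF WU seg[OF \<open>r \<in> ?S\<close>]]]]
      by (simp add: matrix_vector_mul_assoc)
  qed
qed

end

section \<open>Independence of the module\<close>

text \<open>
  The variant of \<open>slice_meromorphic\<close> in which the choice does not occur: the slice is replaced by a whole
  neighbourhood, and \<open>y\<close> by \<open>proj\<close>.
\<close>

definition fibre_meromorphic ::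
  "complex set \<Rightarrow> pt set \<Rightarrow> 'r::finite monopole \<Rightarrow> complex \<Rightarrow> pt \<Rightarrow> 'r sect \<Rightarrow> bool" where
  "fibre_meromorphic \<Gamma> Z M lam x0 s \<longleftrightarrow>
     (\<exists>(n::nat) V \<sigma>. open V \<and> x0 \<in> V \<and> V \<subseteq> reg \<Gamma> Z \<and> minihol M lam V \<sigma> \<and>
       (\<forall>x\<in>V. proj lam x \<noteq> proj lam x0 \<longrightarrow> (proj lam x - proj lam x0) ^ n *s s x = \<sigma> x))"

lemma open_proj_vimage: "open S \<Longrightarrow> open (proj lam -` S)"
  by (intro open_vimage linear_continuous_on bounded_linear_proj)

lemma slice_meromorphic_if_fibre_meromorphic:
  assumes mon: "monopole_on \<Gamma> Z M" and adm: "admissible \<Gamma> lam C" and lam: "cmod lam \<noteq> 1"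
    and mer: "fibre_meromorphic \<Gamma> Z M lam x0 s"
  shows "slice_meromorphic \<Gamma> Z M lam C x0 s"
proof -
  obtain n V \<sigma> where V: "open V" "x0 \<in> V" "V \<subseteq> reg \<Gamma> Z" "minihol M lam V \<sigma>"
    and eq: "\<And>x. x \<in> V \<Longrightarrow> proj lam x \<noteq> proj lam x0 \<Longrightarrow> (proj lam x - proj lam x0) ^ n *s s x = \<sigma> x"
    using mer unfolding fibre_meromorphic_def by blast
  obtain h S where S: "open S" "proj lam x0 \<in> S" and h: "h holomorphic_on S"
    and y: "\<And>x. y_coord lam C x - y_coord lam C x0 = h (proj lam x) * (proj lam x - proj lam x0)"
    using y_coord_difference[OF adm lam, of x0] by metis
  define W where "W = V \<inter> proj lam -` S"
  have W: "open W" "W \<subseteq> reg \<Gamma> Z" "W \<subseteq> V"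
    using V(1,3) open_proj_vimage[OF S(1)] by (auto simp: W_def)
  have "minihol M lam W (\<lambda>x. h (proj lam x) ^ n *s \<sigma> x)"
    by (rule minihol_scale[OF mon W(1,2) minihol_subset[OF V(4) W(3)] holomorphic_on_power[OF h] S(1)])
      (auto simp: W_def)
  moreover have "(y_coord lam C x - y_coord lam C x0) ^ n *s s x = h (proj lam x) ^ n *s \<sigma> x"
    if "x \<in> W" "y_coord lam C x \<noteq> y_coord lam C x0" for x
  proof -
    have "proj lam x \<noteq> proj lam x0" using y[of x] that(2) by auto
    then have "(proj lam x - proj lam x0) ^ n *s s x = \<sigma> x"
      using eq that(1) W(3) by blast
    then show ?thesis
      unfolding y power_mult_distrib vector_smult_assoc[symmetric] by simp
  qed
  ultimately show ?thesis
    using W V(2) S(2) unfolding slice_meromorphic_def W_def by blast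
qed

text \<open>
  Near \<open>x\<^sub>0\<close>, flat transport carries the identity \<open>(y - y(x\<^sub>0))\<^sup>n s = \<sigma>\<close> from the slice to all points off
  the fibre through \<open>x\<^sub>0\<close>: both sides are mini-holomorphic there, and each line in the direction
  \<open>\<partial>\<^sub>\<tau>\<close> meets the slice. Then \<open>y - y(x\<^sub>0)\<close> is replaced by \<open>proj - proj(x\<^sub>0)\<close>, up to an invertible
  factor.
\<close>

lemma fibre_meromorphic_if_slice_meromorphic:
  assumes mon: "monopole_on \<Gamma> Z M" and adm: "admissible \<Gamma> lam C" and lam: "cmod lam \<noteq> 1"
    and x0: "x0 \<in> reg \<Gamma> Z" and "\<epsilon> > 0"
    and hol: "minihol M lam {x. proj lam x \<in> ball (proj lam x0) \<epsilon> - {proj lam x0}} s"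
    and mer: "slice_meromorphic \<Gamma> Z M lam C x0 s"
  shows "fibre_meromorphic \<Gamma> Z M lam x0 s"
proof -
  let ?\<theta> = "coord_field lam (0, 1)"
  define p0 where "p0 = proj lam x0"
  obtain n V \<sigma> where V: "open V" "x0 \<in> V" "V \<subseteq> reg \<Gamma> Z" "minihol M lam V \<sigma>"
    and eq: "\<And>x. x \<in> V \<Longrightarrow> t_coord lam C x = t_coord lam C x0 \<Longrightarrow> y_coord lam C x \<noteq> y_coord lam C x0 \<Longrightarrow>
       (y_coord lam C x - y_coord lam C x0) ^ n *s s x = \<sigma> x"
    using mer unfolding slice_meromorphic_def by blast
  obtain h S where S: "open S" "p0 \<in> S" and h: "h holomorphic_on S" "\<And>p. p \<in> S \<Longrightarrow> h p \<noteq> 0"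
    and y: "\<And>x. y_coord lam C x - y_coord lam C x0 = h (proj lam x) * (proj lam x - p0)"
    unfolding p0_def using y_coord_difference[OF adm lam, of x0] by metis
  obtain \<rho>1 where \<rho>1: "\<rho>1 > 0" "ball x0 \<rho>1 \<subseteq> reg \<Gamma> Z"
    and uniq: "\<And>W s x r. open W \<Longrightarrow> W \<subseteq> ball x0 \<rho>1 \<Longrightarrow> minihol M lam W s \<Longrightarrow>
       (\<And>t. t \<in> closed_segment 0 r \<Longrightarrow> x + t *\<^sub>R ?\<theta> \<in> W) \<Longrightarrow> s x = 0 \<Longrightarrow> s (x + r *\<^sub>R ?\<theta>) = 0"
    using minihol_flat_unique[OF mon x0, of lam] by metis
  define N where "N = ball x0 \<rho>1 \<inter> V \<inter> proj lam -` (S \<inter> ball p0 \<epsilon>)"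
  have "open N"
    unfolding N_def by (intro open_Int open_ball V(1) open_proj_vimage S(1))
  moreover have "x0 \<in> N" using \<rho>1(1) V(2) S(2) \<open>\<epsilon> > 0\<close> by (simp add: N_def p0_def)
  ultimately obtain \<rho> where \<rho>: "\<rho> > 0" "ball x0 \<rho> \<subseteq> N" by (rule openE)
  \<comment> \<open>\<open>flow x\<close> is the point of the slice through \<open>x0\<close> on the flat line through \<open>x\<close>.\<close>
  define flow where "flow = (\<lambda>x. x - (tt_coord lam C x - tt_coord lam C x0) *\<^sub>R ?\<theta>)"
  define B where "B = ball x0 \<rho> \<inter> flow -` ball x0 \<rho>"
  have "continuous_on UNIV flow"
    unfolding flow_def by (intro continuous_intros continuous_on_tt_coord)
  then have "open B" unfolding B_def by (intro open_Int open_vimage open_ball)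
  have "x0 \<in> B" using \<rho>(1) by (simp add: B_def flow_def)
  define W where "W = ball x0 \<rho> \<inter> proj lam -` (- {p0})"
  have W: "open W" "W \<subseteq> ball x0 \<rho>1" "W \<subseteq> V" "W \<subseteq> reg \<Gamma> Z" "proj lam ` W \<subseteq> S \<inter> ball p0 \<epsilon> - {p0}"
    using \<rho>(2) V(3) unfolding W_def N_def by (auto intro: open_Int open_proj_vimage)
  \<comment> \<open>The first term is \<open>(y - y(x0))\<^sup>n s\<close>, with \<open>y - y(x0)\<close> written as a function of \<open>proj\<close>; so \<open>d\<close> is
    mini-holomorphic and vanishes on the slice.\<close>
  define d where "d = (\<lambda>x. (h (proj lam x) * (proj lam x - p0)) ^ n *s s x - \<sigma> x)"
  have "minihol M lam W s"
    using hol by (rule minihol_subset) (use W(5) in \<open>auto simp: p0_def\<close>)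
  then have "minihol M lam W (\<lambda>x. (h (proj lam x) * (proj lam x - p0)) ^ n *s s x)"
    by (rule minihol_scale[OF mon W(1,4) _ _ S(1), where h = "\<lambda>p. (h p * (p - p0)) ^ n"])
      (use W(5) in \<open>auto intro!: holomorphic_intros h\<close>)
  then have d: "minihol M lam W d"
    unfolding d_def by (rule minihol_diff[OF mon W(1,4) _ minihol_subset[OF V(4) W(3)]])
  have proj_flow: "proj lam (x + t *\<^sub>R ?\<theta>) = proj lam x" for x t
    using linear_simps[OF bounded_linear_proj[of lam]] by (simp add: proj_coord_field)
  have zero: "d x = 0" if x: "x \<in> B" "proj lam x \<noteq> p0" for x
  proof -
    define r where "r = tt_coord lam C x - tt_coord lam C x0"
    have x_flow: "x = flow x + r *\<^sub>R ?\<theta>" by (simp add: flow_def r_def)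
    have p_flow: "proj lam (flow x) = proj lam x"
      using proj_flow[of "flow x" r] by (simp add: x_flow[symmetric])
    have in_ball: "x \<in> ball x0 \<rho>" "flow x \<in> ball x0 \<rho>" using x(1) by (auto simp: B_def)
    have "tt_coord lam C (flow x) = tt_coord lam C x0"
      using tt_coord_flow[OF adm lam, of "flow x" r] unfolding x_flow[symmetric] by (simp add: r_def)
    moreover have fV: "flow x \<in> V" "proj lam (flow x) \<in> S" using in_ball(2) \<rho>(2) by (auto simp: N_def)
    moreover have "y_coord lam C (flow x) \<noteq> y_coord lam C x0"
      using y[of "flow x"] h(2)[OF fV(2)] x(2) by (auto simp: p_flow)
    ultimately have "d (flow x) = 0"
      using eq[of "flow x"] by (simp add: d_def t_coord_def y)
    moreover have "flow x + t *\<^sub>R ?\<theta> \<in> W" if t: "t \<in> closed_segment 0 r" for t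
    proof -
      obtain u where u: "0 \<le> u" "u \<le> 1" "t = u * r"
        using t by (auto simp: in_segment)
      have "flow x + t *\<^sub>R ?\<theta> = (1 - u) *\<^sub>R flow x + u *\<^sub>R x"
        by (subst (3) x_flow) (simp add: u(3) algebra_simps)
      then have "flow x + t *\<^sub>R ?\<theta> \<in> closed_segment (flow x) x"
        unfolding in_segment using u by blast
      then have "flow x + t *\<^sub>R ?\<theta> \<in> ball x0 \<rho>"
        using closed_segment_subset[OF in_ball(2,1) convex_ball] by blast
      then show ?thesis using x(2) by (simp add: W_def proj_flow p_flow)
    qed
    \<comment> \<open>Flat transport from the slice to \<open>x\<close>.\<close>
    ultimately show "d x = 0"
      using uniq[OF W(1,2) d, of r "flow x"] by (simp add: x_flow[symmetric])
  qed
  have BS: "B \<subseteq> V" "proj lam ` B \<subseteq> S" "B \<subseteq> reg \<Gamma> Z"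
    using \<rho>(2) V(3) by (auto simp: B_def N_def)
  have "(\<lambda>p. inverse (h p) ^ n) holomorphic_on S"
    using h by (intro holomorphic_intros) auto
  then have "minihol M lam B (\<lambda>x. inverse (h (proj lam x)) ^ n *s \<sigma> x)"
    by (rule minihol_scale[OF mon \<open>open B\<close> BS(3) minihol_subset[OF V(4) BS(1)] _ S(1) BS(2)])
  moreover have "(proj lam x - p0) ^ n *s s x = inverse (h (proj lam x)) ^ n *s \<sigma> x"
    if "x \<in> B" "proj lam x \<noteq> p0" for x
  proof -
    have "h (proj lam x) \<noteq> 0" using h(2) BS(2) that(1) by blast
    then have e: "(proj lam x - p0) ^ n *s s x =
        inverse (h (proj lam x)) ^ n *s ((h (proj lam x) * (proj lam x - p0)) ^ n *s s x)"
      by (simp add: power_mult_distrib[symmetric] mult.assoc[symmetric])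
    have "(h (proj lam x) * (proj lam x - p0)) ^ n *s s x = \<sigma> x"
      using zero[OF that] by (simp add: d_def)
    then show ?thesis unfolding e by simp
  qed
  ultimately show ?thesis
    unfolding fibre_meromorphic_def p0_def[symmetric]
    using \<open>open B\<close> \<open>x0 \<in> B\<close> BS(3) by blast
qed

lemma E_tilde_subset:
  assumes mon: "monopole_on \<Gamma> Z M" and lam: "cmod lam \<noteq> 1" and Z: "finite Z"
    and adm: "admissible \<Gamma> lam C" "admissible \<Gamma> lam C'"
  shows "E_tilde \<Gamma> Z M lam C W \<subseteq> E_tilde \<Gamma> Z M lam C' W"
proof
  fix s assume s: "s \<in> E_tilde \<Gamma> Z M lam C W"
  have "slice_meromorphic \<Gamma> Z M lam C' x0 s"
    if x0: "x0 \<in> reg \<Gamma> Z" "proj lam x0 \<in> W \<inter> divisor \<Gamma> Z lam" for x0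
  proof -
    have "open W" using s by (simp add: E_tilde_def T_open_def)
    then obtain \<epsilon>1 where \<epsilon>1: "\<epsilon>1 > 0" "ball (proj lam x0) \<epsilon>1 \<subseteq> W"
      using x0(2) by (meson IntD1 openE)
    obtain \<epsilon>2 where \<epsilon>2: "\<epsilon>2 > 0" "\<And>P. P \<in> divisor \<Gamma> Z lam \<Longrightarrow> dist (proj lam x0) P < \<epsilon>2 \<Longrightarrow> P = proj lam x0"
      using divisor_isolated[OF _ lam Z, of \<Gamma> "mu1 C" "mu2 C"] adm(1) by (auto simp: admissible_def)
    have "minihol M lam {x. proj lam x \<in> ball (proj lam x0) (min \<epsilon>1 \<epsilon>2) - {proj lam x0}} s"
    proof (rule minihol_subset)
      show "minihol M lam {x. proj lam x \<in> W - divisor \<Gamma> Z lam} s"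
        using s by (simp add: E_tilde_def)
      show "{x. proj lam x \<in> ball (proj lam x0) (min \<epsilon>1 \<epsilon>2) - {proj lam x0}} \<subseteq> {x. proj lam x \<in> W - divisor \<Gamma> Z lam}"
        using \<epsilon>1(2) \<epsilon>2(2) by fastforce
    qed
    moreover have "slice_meromorphic \<Gamma> Z M lam C x0 s"
      using s x0 by (simp add: E_tilde_def)
    moreover have "min \<epsilon>1 \<epsilon>2 > 0" using \<epsilon>1(1) \<epsilon>2(1) by simp
    ultimately have "fibre_meromorphic \<Gamma> Z M lam x0 s"
      using fibre_meromorphic_if_slice_meromorphic[OF mon adm(1) lam x0(1)] by blast
    then show ?thesis
      by (rule slice_meromorphic_if_fibre_meromorphic[OF mon adm(2) lam])
  qed
  with s show "s \<in> E_tilde \<Gamma> Z M lam C' W"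
    by (simp add: E_tilde_def)
qed

lemma E_tilde_independent:
  assumes "monopole_on \<Gamma> Z M" and "cmod lam \<noteq> 1" and "finite Z"
    and "admissible \<Gamma> lam C" and "admissible \<Gamma> lam C'"
  shows "E_tilde \<Gamma> Z M lam C = E_tilde \<Gamma> Z M lam C'"
  using E_tilde_subset[OF assms] E_tilde_subset[OF assms(1-3,5,4)] by (intro ext equalityI)

section \<open>Change of scale in the parabolic structure\<close>

text \<open>
  The effect on sides and on lists of a change of scale by \<open>r\<close>; only \<open>r \<noteq> 0\<close> is meaningful.
\<close>

definition turn_side :: "real \<Rightarrow> side \<Rightarrow> side" where
  "turn_side r sd = (if r > 0 then sd else opp sd)"

definition turn_list :: "real \<Rightarrow> 'a list \<Rightarrow> 'a list" where
  "turn_list r xs = (if r > 0 then xs else rev xs)"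

lemma turn_side_mult:
  "a \<noteq> 0 \<Longrightarrow> b \<noteq> 0 \<Longrightarrow> turn_side (a * b) sd = turn_side a (turn_side b sd)"
  by (cases sd) (auto simp: turn_side_def zero_less_mult_iff)

lemma rescale_eq:
  assumes "c \<noteq> 0"
  shows "rescale c H =
    \<lparr> fo_divisor = fo_divisor H,
      fo_sections = fo_sections H,
      fo_points = (\<lambda>P. turn_list c (map ((*) c) (fo_points H P))),
      fo_lattices = (\<lambda>P. turn_list c (fo_lattices H P)),
      fo_filt = (\<lambda>sd. fo_filt H (turn_side c sd)),
      fo_gr_filt = (\<lambda>sd Q \<mu> b. fo_gr_filt H (turn_side c sd) Q \<mu> (b / \<bar>c\<bar>)) \<rparr>"
  using assms by (simp add: rescale_def turn_list_def turn_side_def)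

lemma sorted_list_of_set_scale:
  fixes A :: "real set"
  assumes "r \<noteq> 0"
  shows "sorted_list_of_set ((*) r ` A) = turn_list r (map ((*) r) (sorted_list_of_set A))"
proof (cases "finite A")
  case True
  let ?xs = "turn_list r (map ((*) r) (sorted_list_of_set A))"
  have "sorted_wrt (\<lambda>x y. r * x \<le> r * y) (sorted_list_of_set A)" if "r > 0"
    using that sorted_wrt_mono_rel[OF _ sorted_sorted_list_of_set[of A]] by simp
  moreover have "sorted_wrt (\<lambda>x y. r * y \<le> r * x) (sorted_list_of_set A)" if "r < 0"
    using that sorted_wrt_mono_rel[OF _ sorted_sorted_list_of_set[of A]] by (simp add: mult_left_mono_neg)
  ultimately have "sorted ?xs"
    using assms by (auto simp: turn_list_def sorted_wrt_map sorted_wrt_rev)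
  moreover have "distinct ?xs" "set ?xs = (*) r ` A"
    using assms True by (auto simp: turn_list_def distinct_map inj_on_def)
  ultimately show ?thesis
    using sorted_list_of_set.idem_if_sorted_distinct by metis
next
  case False
  then have "infinite ((*) r ` A)"
    using assms finite_image_iff[of "(*) r" A] by (auto simp: inj_on_def)
  with False show ?thesis by (simp add: turn_list_def)
qed

lemma filtercomap_scale:
  fixes g :: "'a \<Rightarrow> real"
  assumes "r \<noteq> 0"
  shows "filtercomap (\<lambda>x. r * g x) at_top = filtercomap g (if r > 0 then at_top else at_bot)"
    and "filtercomap (\<lambda>x. r * g x) at_bot = filtercomap g (if r > 0 then at_bot else at_top)"
proof -
  have div: "(\<exists>N. \<forall>x. N \<le> r * g x \<longrightarrow> P x) \<longleftrightarrow> (\<exists>N. \<forall>x. r * N \<le> r * g x \<longrightarrow> P x)"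
    "(\<exists>N. \<forall>x. r * g x \<le> N \<longrightarrow> P x) \<longleftrightarrow> (\<exists>N. \<forall>x. r * g x \<le> r * N \<longrightarrow> P x)" for P
    using assms by (metis nonzero_mult_div_cancel_left times_divide_eq_right)+
  show "filtercomap (\<lambda>x. r * g x) at_top = filtercomap g (if r > 0 then at_top else at_bot)"
    "filtercomap (\<lambda>x. r * g x) at_bot = filtercomap g (if r > 0 then at_bot else at_top)"
    using assms
    by (auto simp: filter_eq_iff eventually_filtercomap_at_top_linorder eventually_filtercomap_at_bot_linorder div)
qed

lemma all_pos_scale:
  fixes P :: "real \<Rightarrow> bool"
  assumes "c > 0"
  shows "(\<forall>\<epsilon>>0. P (c * \<epsilon>)) \<longleftrightarrow> (\<forall>\<epsilon>>0. P \<epsilon>)"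
proof (intro iffI allI impI)
  fix \<epsilon> :: real assume "\<forall>\<epsilon>>0. P (c * \<epsilon>)" "\<epsilon> > 0"
  then have "P (c * (\<epsilon> / c))" using assms by (meson divide_pos_pos)
  then show "P \<epsilon>" using assms by simp
qed (use assms in simp)

text \<open>
  The three facts about a pair of choices from which everything else follows: the functions \<open>f\<close> are
  proportional, the logarithms change by the square of the factor, and the modules agree.
\<close>

context
  fixes \<Gamma> :: "complex set" and Z :: "pt set" and M :: "'r::finite monopole" and lam :: complex
    and C C' :: choice and r :: real
  assumes r: "r \<noteq> 0"
    and f: "\<And>x. f_fun lam C x = r * f_fun lam C' x"
    and q: "log_abs_q lam C' = r\<^sup>2 * log_abs_q lam C"
    and E: "E_tilde \<Gamma> Z M lam C = E_tilde \<Gamma> Z M lam C'"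
begin

lemma E_tilde_near_eq: "E_tilde_near \<Gamma> Z M lam C = E_tilde_near \<Gamma> Z M lam C'"
  by (intro ext) (simp add: E_tilde_near_def E)

lemma adic_Cauchy_eq: "adic_Cauchy \<Gamma> Z M lam C = adic_Cauchy \<Gamma> Z M lam C'"
  by (intro ext) (simp add: adic_Cauchy_def E_tilde_near_eq)

lemma formal_class_eq: "formal_class \<Gamma> Z M lam C = formal_class \<Gamma> Z M lam C'"
  by (intro ext) (simp add: formal_class_def adic_Cauchy_eq)

lemma par_points_eq: "par_points \<Gamma> Z lam C P = turn_list r (map ((*) r) (par_points \<Gamma> Z lam C' P))"
proof -
  have "f_fun lam C ` A = (*) r ` (f_fun lam C' ` A)" for A
    by (auto simp: f image_iff)
  then show ?thesis by (simp add: par_points_def sorted_list_of_set_scale[OF r])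
qed

text \<open>
  For \<open>r < 0\<close> the inequalities between \<open>f\<close> and the points are reversed together with the list, so the
  interval number \<open>i\<close> out of \<open>0, \<dots>, m\<close> becomes number \<open>m - i\<close>.
\<close>

lemma completed_stalk_eq:
  assumes "i \<le> length (par_points \<Gamma> Z lam C' P)"
  shows "completed_stalk \<Gamma> Z M lam C P i = completed_stalk \<Gamma> Z M lam C' P
     (if r > 0 then i else length (par_points \<Gamma> Z lam C' P) - i)"
proof -
  define L where "L = par_points \<Gamma> Z lam C' P"
  define j where "j = (if r > 0 then i else length L - i)"
  have C: "par_points \<Gamma> Z lam C P = turn_list r (map ((*) r) L)" by (simp add: L_def par_points_eq)
  have "((i > 0 \<longrightarrow> par_points \<Gamma> Z lam C P ! (i - 1) < f_fun lam C x) \<and>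
        (i < length (par_points \<Gamma> Z lam C P) \<longrightarrow> f_fun lam C x < par_points \<Gamma> Z lam C P ! i)) \<longleftrightarrow>
      ((j > 0 \<longrightarrow> L ! (j - 1) < f_fun lam C' x) \<and>
        (j < length L \<longrightarrow> f_fun lam C' x < L ! j))" for x
  proof (cases "r > 0")
    case True
    with assms show ?thesis by (simp add: C f turn_list_def j_def L_def[symmetric])
  next
    case False
    with r have neg: "r < 0" by simp
    have i: "i \<le> length L" using assms by (simp add: L_def)
    have "rev (map ((*) r) L) ! (i - 1) = r * L ! j" if "i > 0"
      using that i neg by (simp add: rev_nth j_def)
    moreover have "rev (map ((*) r) L) ! i = r * L ! (j - 1)" if "i < length L"
      using that neg by (simp add: rev_nth j_def)
    moreover have "i > 0 \<longleftrightarrow> j < length L" "i < length L \<longleftrightarrow> j > 0"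
      using i neg by (auto simp: j_def)
    ultimately show ?thesis using neg by (auto simp: C f turn_list_def)
  qed
  then show ?thesis
    unfolding L_def[symmetric] j_def[symmetric]
    by (simp add: completed_stalk_def adic_Cauchy_eq formal_class_eq L_def[symmetric])
qed

lemma par_lattices_eq: "par_lattices \<Gamma> Z M lam C P = turn_list r (par_lattices \<Gamma> Z M lam C' P)"
proof (cases "P \<in> divisor \<Gamma> Z lam")
  case True
  have len: "length (par_points \<Gamma> Z lam C P) = length (par_points \<Gamma> Z lam C' P)"
    by (simp add: par_points_eq turn_list_def)
  show ?thesis
  proof (rule nth_equalityI)
    show "length (par_lattices \<Gamma> Z M lam C P) = length (turn_list r (par_lattices \<Gamma> Z M lam C' P))"
      using True by (simp add: par_lattices_def len turn_list_def)
    fix i assume "i < length (par_lattices \<Gamma> Z M lam C P)"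
    then have "i < Suc (length (par_points \<Gamma> Z lam C' P))"
      using True by (simp add: par_lattices_def len)
    then show "par_lattices \<Gamma> Z M lam C P ! i = turn_list r (par_lattices \<Gamma> Z M lam C' P) ! i"
      using True by (simp add: par_lattices_def len turn_list_def rev_nth completed_stalk_eq del: upt_Suc)
  qed
qed (simp add: par_lattices_def turn_list_def)

lemma end_lattice_eq:
  assumes "P \<in> divisor \<Gamma> Z lam"
  shows "end_lattice \<Gamma> Z M lam sd C P = end_lattice \<Gamma> Z M lam (turn_side r sd) C' P"
proof -
  have "par_lattices \<Gamma> Z M lam C' P \<noteq> []" using assms by (simp add: par_lattices_def)
  then show ?thesis
    by (cases sd) (simp_all add: par_lattices_eq turn_list_def turn_side_def hd_rev last_rev)
qed

lemma E_end_eq: "E_end \<Gamma> Z M lam sd C = E_end \<Gamma> Z M lam (turn_side r sd) C'"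
  by (intro ext) (auto simp: E_end_def E formal_class_eq end_lattice_eq)

lemma E_end_near_eq: "E_end_near \<Gamma> Z M lam sd C = E_end_near \<Gamma> Z M lam (turn_side r sd) C'"
  by (intro ext) (simp add: E_end_near_def E_end_eq)

lemma fibre_class_eq: "fibre_class \<Gamma> Z M lam sd C = fibre_class \<Gamma> Z M lam (turn_side r sd) C'"
  by (intro ext) (simp add: fibre_class_def vanishes_at_def E_end_near_eq)

lemma filtercomap_f_fun:
  "filtercomap (f_fun lam C) at_top = filtercomap (f_fun lam C') (if r > 0 then at_top else at_bot)"
  "filtercomap (f_fun lam C) at_bot = filtercomap (f_fun lam C') (if r > 0 then at_bot else at_top)"
  using r filtercomap_scale[of r "f_fun lam C'"] by (simp_all add: f[abs_def])

lemma end_filter_eq: "end_filter lam sd C Q = end_filter lam (turn_side r sd) C' Q"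
  by (cases sd) (simp_all add: filtercomap_f_fun turn_side_def)

text \<open>
  The factors \<open>r\<^sup>2\<close> of \<open>f\<^sup>2\<close> and of the logarithm cancel in the leading term; in the error term one is
  left, which is absorbed into \<open>\<epsilon>\<close>.
\<close>

lemma growth_F_eq: "growth_F \<Gamma> Z M lam sd C Q \<mu> \<sigma> = growth_F \<Gamma> Z M lam (turn_side r sd) C' Q \<mu> \<sigma>"
proof -
  have "(of_rat \<mu> / 2 * log_abs_q lam C + \<epsilon>) * (f_fun lam C x)\<^sup>2 =
      (of_rat \<mu> / 2 * log_abs_q lam C' + r\<^sup>2 * \<epsilon>) * (f_fun lam C' x)\<^sup>2" for \<epsilon> x
    by (simp add: f q power_mult_distrib algebra_simps)
  then show ?thesis
    using r by (simp only: growth_F_def end_filter_eq) (rule all_pos_scale, simp)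
qed

text \<open>
  Here the logarithm contributes \<open>r\<^sup>2\<close> and \<open>\<bar>f\<bar>\<close> only \<open>\<bar>r\<bar>\<close>, so a factor \<open>\<bar>r\<bar>\<close> moves into the index.
\<close>

lemma growth_Gr_eq:
  "growth_Gr \<Gamma> Z M lam sd C Q \<mu> b \<sigma> = growth_Gr \<Gamma> Z M lam (turn_side r sd) C' Q \<mu> (b / \<bar>r\<bar>) \<sigma>"
proof -
  have "of_rat \<mu> / 2 * log_abs_q lam C * (f_fun lam C x)\<^sup>2 + (b + \<epsilon>) * log_abs_q lam C * \<bar>f_fun lam C x\<bar> =
      of_rat \<mu> / 2 * log_abs_q lam C' * (f_fun lam C' x)\<^sup>2 +
        (b / \<bar>r\<bar> + 1 / \<bar>r\<bar> * \<epsilon>) * log_abs_q lam C' * \<bar>f_fun lam C' x\<bar>" for \<epsilon> x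
  proof -
    have "r\<^sup>2 = \<bar>r\<bar> * \<bar>r\<bar>" by (simp add: power2_eq_square)
    then have lin: "(b + \<epsilon>) * log_abs_q lam C * \<bar>f_fun lam C x\<bar> =
        (b / \<bar>r\<bar> + 1 / \<bar>r\<bar> * \<epsilon>) * log_abs_q lam C' * \<bar>f_fun lam C' x\<bar>"
      using r by (simp add: f q abs_mult field_simps)
    have quad: "of_rat \<mu> / 2 * log_abs_q lam C * (f_fun lam C x)\<^sup>2 = of_rat \<mu> / 2 * log_abs_q lam C' * (f_fun lam C' x)\<^sup>2"
      by (simp add: f q power_mult_distrib)
    show ?thesis unfolding lin quad by (rule refl)
  qed
  moreover have "1 / \<bar>r\<bar> > 0" using r by simp
  ultimately show ?thesis
    by (simp only: growth_Gr_def end_filter_eq) (rule all_pos_scale)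
qed

lemma filt_eq: "filt \<Gamma> Z M lam sd C = filt \<Gamma> Z M lam (turn_side r sd) C'"
  by (intro ext) (simp add: filt_def fibre_class_eq E_end_near_eq growth_F_eq)

lemma gr_class_eq: "gr_class \<Gamma> Z M lam sd C = gr_class \<Gamma> Z M lam (turn_side r sd) C'"
  by (intro ext) (simp add: gr_class_def fibre_class_eq E_end_near_eq growth_F_eq filt_eq)

lemma gr_filt_eq: "gr_filt \<Gamma> Z M lam sd C Q \<mu> b = gr_filt \<Gamma> Z M lam (turn_side r sd) C' Q \<mu> (b / \<bar>r\<bar>)"
  by (simp add: gr_filt_def gr_class_eq E_end_near_eq growth_F_eq growth_Gr_eq)

text \<open>
  The sign rules of the rescaling are multiplicative, so the change of scale by \<open>r\<close> between the two
  choices combines with the rescaling by \<open>t\<close>.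
\<close>

lemma rescale_associated_object_eq:
  assumes "t \<noteq> 0"
  shows "rescale t (associated_object \<Gamma> Z M lam C) = rescale (r * t) (associated_object \<Gamma> Z M lam C')"
proof -
  have "turn_list t (map ((*) t) (turn_list r (map ((*) r) xs))) = turn_list (r * t) (map ((*) (r * t)) xs)" for xs
    using assms r by (auto simp: turn_list_def rev_map zero_less_mult_iff mult_ac)
  moreover have "turn_list t (turn_list r xs) = turn_list (r * t) xs" for xs :: "(nat \<Rightarrow> 'r sect) set set list"
    using assms r by (auto simp: turn_list_def zero_less_mult_iff)
  moreover have "turn_side r (turn_side t sd) = turn_side (r * t) sd" for sd
    using turn_side_mult[OF r assms] by simp
  moreover have "\<bar>r * t\<bar> = \<bar>t\<bar> * \<bar>r\<bar>"
    by (simp add: abs_mult mult.commute)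
  ultimately show ?thesis
    using assms r by (simp add: rescale_eq associated_object_def E par_points_eq par_lattices_eq filt_eq gr_filt_eq)
qed

end

section \<open>Independence of the choice\<close>

theorem theorem1p7:
  fixes \<Gamma> :: "complex set" and lam :: complex and Z :: "pt set"
    and M :: "'r::finite monopole" and C C' :: choice
  assumes "is_lattice \<Gamma>"
    and "cmod lam \<noteq> 1"
    and "finite Z"
    and "meromorphic_monopole \<Gamma> Z M"
    and "admissible \<Gamma> lam C"
    and "admissible \<Gamma> lam C'"
  shows "rescale (t_lam C) (associated_object \<Gamma> Z M lam C) =
         rescale (t_lam C') (associated_object \<Gamma> Z M lam C')"
proof -
  have mon: "monopole_on \<Gamma> Z M" using assms(4) by (simp add: meromorphic_monopole_def)
  define r where "r = t_lam C' / t_lam C"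
  have t: "t_lam C \<noteq> 0" "t_lam C' \<noteq> 0"
    by (rule t_lam_nonzero[OF assms(5,2)] t_lam_nonzero[OF assms(6,2)])+
  then have r: "r \<noteq> 0" by (simp add: r_def)
  have f: "f_fun lam C x = r * f_fun lam C' x" for x
  proof -
    have "t_lam C * f_fun lam C x = t_lam C' * f_fun lam C' x"
      unfolding t_lam_f_fun[OF assms(5,2)] t_lam_f_fun[OF assms(6,2)] by (rule refl)
    then show ?thesis using t(1) by (simp add: r_def nonzero_eq_divide_eq mult.commute)
  qed
  have area: "Im (cnj (mu1 C') * mu2 C') = Im (cnj (mu1 C) * mu2 C)"
    by (rule area_independent[of \<Gamma>]) (use assms(5,6) in \<open>simp_all add: admissible_def\<close>)
  have "K * (t_lam C')\<^sup>2 = r\<^sup>2 * (K * (t_lam C)\<^sup>2)" for K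
    using t by (simp add: r_def power_divide)
  then have q: "log_abs_q lam C' = r\<^sup>2 * log_abs_q lam C"
    unfolding log_abs_q_eq[OF assms(5,2)] log_abs_q_eq[OF assms(6,2)] area .
  have E: "E_tilde \<Gamma> Z M lam C = E_tilde \<Gamma> Z M lam C'"
    by (rule E_tilde_independent[OF mon assms(2,3,5,6)])
  have "r * t_lam C = t_lam C'" using t by (simp add: r_def)
  with rescale_associated_object_eq[OF r f q E t(1)] show ?thesis by simp
qed

end
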